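(* Let $\Sigma$ be a connected finite flag complex that is triangle-free. Then $\mathrm{def}(\Gamma_n)\to\infty$ as $n\to\infty$ if and only if $H_\Sigma=\bigcap_{n\ge 1}\Gamma_n$ is not finitely presentable.
   Context: A flag complex is a simplicial complex in which every set of pairwise adjacent vertices spans a simplex; it is triangle-free if its $1$-skeleton has no cycles of length $3$. For a finite flag complex $\Sigma$ with vertices $a_1,\dots,a_N$, $G_\Sigma=\langle e_1,\dots,e_N \mid [e_i,e_j]\text{ for each edge }\{a_i,a_j\}\in\Sigma\rangle$, $\pi:G_\Sigma\to\mathbf{Z}$ is the surjection sending every $e_i$ to $1$, $H_\Sigma=\ker\pi$, and $\Gamma_n=\pi^{-1}(n\mathbf{Z})$ for $n\ge1$. The deficiency of a finite presentation is the number of relations minus the number of generators (for a presentation $F/R$ with $F$ free, the minimal number of normal generators of $R$ minus the rank of $F$), and $\mathrm{def}(\Gamma)$ is the infimum of the deficiencies of the finite presentations of the finitely presented group $\Gamma$. *)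

theory Defs
  imports "HOL-Algebra.Elementary_Groups" "HOL-Library.Extended_Real"
begin

subsection \<open>Free groups and presentations\<close>

text \<open>A letter \<open>(x, True)\<close> stands for the generator \<open>x\<close>, and \<open>(x, False)\<close> for its inverse.
  The free group on \<open>X\<close> consists of the reduced words over \<open>X\<close>; the product is
  concatenation followed by free reduction.\<close>

type_synonym 'a word = "('a \<times> bool) list"

definition letter_inv :: "'a \<times> bool \<Rightarrow> 'a \<times> bool" where
  "letter_inv l = (fst l, \<not> snd l)"

fun reduced :: "'a word \<Rightarrow> bool" where
  "reduced (l # m # w) \<longleftrightarrow> m \<noteq> letter_inv l \<and> reduced (m # w)"
| "reduced _ \<longleftrightarrow> True"

fun reduced_cons :: "'a \<times> bool \<Rightarrow> 'a word \<Rightarrow> 'a word" where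
  "reduced_cons l [] = [l]"
| "reduced_cons l (m # w) = (if m = letter_inv l then w else l # m # w)"

definition free_group :: "'a set \<Rightarrow> 'a word monoid" where
  "free_group X = \<lparr>carrier = {w. reduced w \<and> fst ` set w \<subseteq> X},
     monoid.mult = (\<lambda>u v. foldr reduced_cons u v), one = []\<rparr>"

definition normal_closure :: "('g, 'm) monoid_scheme \<Rightarrow> 'g set \<Rightarrow> 'g set" where
  "normal_closure G R = \<Inter> {N. N \<lhd> G \<and> R \<subseteq> N}"

definition presented_group :: "'a set \<Rightarrow> 'a word set \<Rightarrow> 'a word set monoid" where
  "presented_group X R = free_group X Mod normal_closure (free_group X) R"

definition is_finite_presentation ::
    "('g, 'm) monoid_scheme \<Rightarrow> nat \<Rightarrow> nat word set \<Rightarrow> bool" where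
  "is_finite_presentation G d R \<longleftrightarrow>
     finite R \<and> R \<subseteq> carrier (free_group {..<d}) \<and> G \<cong> presented_group {..<d} R"

definition finitely_presentable :: "('g, 'm) monoid_scheme \<Rightarrow> bool" where
  "finitely_presentable G \<longleftrightarrow> (\<exists>d R. is_finite_presentation G d R)"

text \<open>The sign convention is relations minus generators. The infimum is taken in the extended
  reals, so it is meaningful without a prior lower bound; it is \<open>\<infinity>\<close> if \<open>G\<close> is not finitely
  presentable.\<close>

definition deficiency :: "('g, 'm) monoid_scheme \<Rightarrow> ereal" where
  "deficiency G =
     Inf {ereal (real (card R) - real d) | d R. is_finite_presentation G d R}"


subsection \<open>Simplicial complexes\<close>

text \<open>An abstract simplicial complex is given by its set of non-empty simplices.\<close>

definition finite_simplicial_complex :: "'a set set \<Rightarrow> bool" where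
  "finite_simplicial_complex K \<longleftrightarrow> finite K \<and>
     (\<forall>s\<in>K. finite s \<and> s \<noteq> {} \<and> (\<forall>t. t \<subseteq> s \<and> t \<noteq> {} \<longrightarrow> t \<in> K))"

definition vertices :: "'a set set \<Rightarrow> 'a set" where
  "vertices K = \<Union> K"

definition adjacent :: "'a set set \<Rightarrow> 'a \<Rightarrow> 'a \<Rightarrow> bool" where
  "adjacent K u v \<longleftrightarrow> u \<noteq> v \<and> {u, v} \<in> K"

definition flag_complex :: "'a set set \<Rightarrow> bool" where
  "flag_complex K \<longleftrightarrow>
     (\<forall>s. finite s \<and> s \<noteq> {} \<and> s \<subseteq> vertices K \<and>
          (\<forall>u\<in>s. \<forall>v\<in>s. u \<noteq> v \<longrightarrow> adjacent K u v) \<longrightarrow> s \<in> K)"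

definition triangle_free :: "'a set set \<Rightarrow> bool" where
  "triangle_free K \<longleftrightarrow> \<not> (\<exists>u v w. adjacent K u v \<and> adjacent K v w \<and> adjacent K w u)"

text \<open>Connectedness of the 1-skeleton, which for a simplicial complex is the same as connectedness
  of its geometric realization. The empty complex is not excluded.\<close>

definition connected_complex :: "'a set set \<Rightarrow> bool" where
  "connected_complex K \<longleftrightarrow>
     (\<forall>u\<in>vertices K. \<forall>v\<in>vertices K. (adjacent K)\<^sup>*\<^sup>* u v)"


subsection \<open>The right-angled Artin group of a complex\<close>

definition raag_relators :: "'a set set \<Rightarrow> 'a word set" where
  "raag_relators K =
     {[(u, True), (v, True), (u, False), (v, False)] | u v. adjacent K u v}"

definition raag :: "'a set set \<Rightarrow> 'a word set monoid" where
  "raag K = presented_group (vertices K) (raag_relators K)"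

definition raag_gen :: "'a set set \<Rightarrow> 'a \<Rightarrow> 'a word set" where
  "raag_gen K v =
     normal_closure (free_group (vertices K)) (raag_relators K)
       #>\<^bsub>free_group (vertices K)\<^esub> [(v, True)]"

definition exponent_sum :: "'a word \<Rightarrow> int" where
  "exponent_sum w = (\<Sum>l\<leftarrow>w. if snd l then 1 else - 1)"

text \<open>An element of the right-angled Artin group is a coset, on which the exponent sum is
  constant. That \<open>raag_pi K\<close> is the homomorphism sending each generator to \<open>1\<close>, as it should
  be, is shown in \<open>raag_pi_hom\<close> and \<open>raag_pi_gen\<close> below.\<close>

definition raag_pi :: "'a set set \<Rightarrow> 'a word set \<Rightarrow> int" where
  "raag_pi K g = the_elem (exponent_sum ` g)"

definition raag_H :: "'a set set \<Rightarrow> 'a word set set" where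
  "raag_H K = kernel (raag K) integer_group (raag_pi K)"

definition raag_Gamma :: "'a set set \<Rightarrow> nat \<Rightarrow> 'a word set set" where
  "raag_Gamma K n = {g \<in> carrier (raag K). int n dvd raag_pi K g}"


subsection \<open>Well-definedness\<close>

lemma letter_inv_inv [simp]: "letter_inv (letter_inv l) = l"
  by (simp add: letter_inv_def)

lemma reduced_tl: "reduced (l # w) \<Longrightarrow> reduced w"
  by (cases w) auto

lemma reduced_reduced_cons: "reduced w \<Longrightarrow> reduced (reduced_cons l w)"
  by (cases w) (auto dest: reduced_tl)

lemma reduced_foldr: "reduced w \<Longrightarrow> reduced (foldr reduced_cons u w)"
  by (induction u) (auto intro: reduced_reduced_cons)

lemma set_reduced_cons: "set (reduced_cons l w) \<subseteq> insert l (set w)"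
  by (cases w) auto

lemma set_foldr_reduced_cons: "set (foldr reduced_cons u w) \<subseteq> set u \<union> set w"
  using set_reduced_cons by (induction u) fastforce+

lemma reduced_cons_cancel:
  assumes "reduced w"
  shows "reduced_cons l (reduced_cons (letter_inv l) w) = w"
proof (cases w)
  case (Cons m v)
  then show ?thesis using assms by (cases v) auto
qed simp

lemma foldr_reduced_cons_step:
  assumes "reduced w"
  shows "foldr reduced_cons (reduced_cons l u) w = reduced_cons l (foldr reduced_cons u w)"
  using assms by (cases u) (auto simp: reduced_cons_cancel reduced_foldr)

lemma foldr_reduced_cons_assoc:
  assumes "reduced w"
  shows "foldr reduced_cons (foldr reduced_cons u v) w =
         foldr reduced_cons u (foldr reduced_cons v w)"
  using assms by (induction u) (auto simp: foldr_reduced_cons_step)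

lemma foldr_reduced_cons_Nil: "reduced u \<Longrightarrow> foldr reduced_cons u [] = u"
proof (induction u)
  case (Cons l u)
  then show ?case by (cases u) auto
qed simp

lemma foldr_reduced_cons_inv:
  "foldr reduced_cons (rev (map letter_inv u)) u = []"
  by (induction u) auto

lemma group_free_group: "group (free_group X)"
proof (rule groupI)
  fix u v w
  assume u: "u \<in> carrier (free_group X)" and v: "v \<in> carrier (free_group X)"
  show "u \<otimes>\<^bsub>free_group X\<^esub> v \<in> carrier (free_group X)"
    using u v set_foldr_reduced_cons[of u v] reduced_foldr[of v u]
    by (fastforce simp: free_group_def)
  assume "w \<in> carrier (free_group X)"
  then show "u \<otimes>\<^bsub>free_group X\<^esub> v \<otimes>\<^bsub>free_group X\<^esub> w =
      u \<otimes>\<^bsub>free_group X\<^esub> (v \<otimes>\<^bsub>free_group X\<^esub> w)"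
    by (simp add: free_group_def foldr_reduced_cons_assoc)
next
  fix u assume u: "u \<in> carrier (free_group X)"
  let ?v = "foldr reduced_cons (rev (map letter_inv u)) []"
  have "?v \<otimes>\<^bsub>free_group X\<^esub> u = []"
    using u by (simp add: free_group_def foldr_reduced_cons_assoc foldr_reduced_cons_inv)
  moreover have "set ?v \<subseteq> letter_inv ` set u"
    using set_foldr_reduced_cons[of "rev (map letter_inv u)" "[]"] by simp
  then have "fst ` set ?v \<subseteq> fst ` letter_inv ` set u" by (rule image_mono)
  then have "fst ` set ?v \<subseteq> fst ` set u" by (simp add: image_image letter_inv_def)
  then have "?v \<in> carrier (free_group X)"
    using u reduced_foldr[of "[]"] by (auto simp: free_group_def)
  ultimately show "\<exists>v\<in>carrier (free_group X). v \<otimes>\<^bsub>free_group X\<^esub> u = \<one>\<^bsub>free_group X\<^esub>"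
    by (auto simp: free_group_def)
qed (auto simp: free_group_def)

lemma normal_closure_normal:
  assumes "group G" "R \<subseteq> carrier G"
  shows "normal_closure G R \<lhd> G"
proof -
  interpret group G by fact
  have carr: "carrier G \<lhd> G"
    by (simp add: normal_inv_iff subgroup_self)
  have "subgroup (normal_closure G R) G"
    unfolding normal_closure_def
    using carr assms(2) by (intro subgroups_Inter) (auto dest: normal_imp_subgroup)
  then show ?thesis
    by (auto simp: normal_inv_iff) (auto simp: normal_closure_def normal_inv_iff)
qed

lemma group_presented_group:
  assumes "R \<subseteq> carrier (free_group X)"
  shows "group (presented_group X R)"
  unfolding presented_group_def
  by (intro normal.factorgroup_is_group normal_closure_normal group_free_group assms)

lemma raag_relators_subset: "raag_relators K \<subseteq> carrier (free_group (vertices K))"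
  by (auto simp: raag_relators_def free_group_def letter_inv_def adjacent_def vertices_def)

lemma group_raag: "group (raag K)"
  unfolding raag_def by (rule group_presented_group[OF raag_relators_subset])

lemma exponent_sum_reduced_cons:
  "exponent_sum (reduced_cons l w) = (if snd l then 1 else - 1) + exponent_sum w"
  by (cases w) (auto simp: exponent_sum_def letter_inv_def)

lemma exponent_sum_hom: "exponent_sum \<in> hom (free_group X) integer_group"
proof (rule homI)
  fix u v :: "'a word"
  have "exponent_sum (foldr reduced_cons u v) = exponent_sum u + exponent_sum v"
    by (induction u) (auto simp: exponent_sum_reduced_cons, auto simp: exponent_sum_def)
  then show "exponent_sum (u \<otimes>\<^bsub>free_group X\<^esub> v) =
      exponent_sum u \<otimes>\<^bsub>integer_group\<^esub> exponent_sum v"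
    by (simp add: free_group_def integer_group_def)
qed simp

lemma exponent_sum_normal_closure:
  assumes "n \<in> normal_closure (free_group (vertices K)) (raag_relators K)"
  shows "exponent_sum n = 0"
proof -
  interpret group_hom "free_group (vertices K)" integer_group exponent_sum
    by (simp add: group_hom_def group_hom_axioms_def group_free_group exponent_sum_hom)
  have "raag_relators K \<subseteq> kernel (free_group (vertices K)) integer_group exponent_sum"
    using raag_relators_subset[of K]
    by (auto simp: kernel_def raag_relators_def exponent_sum_def)
  then have "n \<in> kernel (free_group (vertices K)) integer_group exponent_sum"
    using assms normal_kernel by (auto simp: normal_closure_def)
  then show ?thesis by (simp add: kernel_def)
qed

lemma raag_pi_coset:
  assumes w: "w \<in> carrier (free_group (vertices K))"
  shows "raag_pi K (normal_closure (free_group (vertices K)) (raag_relators K)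
           #>\<^bsub>free_group (vertices K)\<^esub> w) = exponent_sum w"
proof -
  let ?F = "free_group (vertices K)" and ?N = "normal_closure (free_group (vertices K)) (raag_relators K)"
  have nrm: "?N \<lhd> ?F"
    by (rule normal_closure_normal[OF group_free_group raag_relators_subset])
  then have sub: "?N \<subseteq> carrier ?F" and one: "\<one>\<^bsub>?F\<^esub> \<in> ?N"
    by (auto dest!: normal_imp_subgroup intro: subgroup.one_closed dest: subgroup.subset)
  have "exponent_sum (n \<otimes>\<^bsub>?F\<^esub> w) = exponent_sum w" if "n \<in> ?N" for n
    using hom_mult[OF exponent_sum_hom, of n "vertices K" w] that sub w
      exponent_sum_normal_closure[OF that]
    by (auto simp: integer_group_def)
  then have "exponent_sum ` (?N #>\<^bsub>?F\<^esub> w) = {exponent_sum w}"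
    using one by (force simp: r_coset_def image_iff)
  then show ?thesis by (simp add: raag_pi_def)
qed

lemma raag_pi_hom: "raag_pi K \<in> hom (raag K) integer_group"
proof (rule homI)
  let ?F = "free_group (vertices K)" and ?N = "normal_closure (free_group (vertices K)) (raag_relators K)"
  have nrm: "?N \<lhd> ?F"
    by (rule normal_closure_normal[OF group_free_group raag_relators_subset])
  fix g h assume "g \<in> carrier (raag K)" "h \<in> carrier (raag K)"
  then obtain u v where u: "u \<in> carrier ?F" "g = ?N #>\<^bsub>?F\<^esub> u"
    and v: "v \<in> carrier ?F" "h = ?N #>\<^bsub>?F\<^esub> v"
    by (auto simp: raag_def presented_group_def FactGroup_def RCOSETS_def)
  have uv: "u \<otimes>\<^bsub>?F\<^esub> v \<in> carrier ?F"
    using u(1) v(1) group_free_group by (metis group.is_monoid monoid.m_closed)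
  have "g \<otimes>\<^bsub>raag K\<^esub> h = ?N #>\<^bsub>?F\<^esub> (u \<otimes>\<^bsub>?F\<^esub> v)"
    using normal.rcos_sum[OF nrm u(1) v(1)] u v
    by (simp add: raag_def presented_group_def FactGroup_def)
  then show "raag_pi K (g \<otimes>\<^bsub>raag K\<^esub> h) = raag_pi K g \<otimes>\<^bsub>integer_group\<^esub> raag_pi K h"
    using u v uv hom_mult[OF exponent_sum_hom u(1) v(1)] by (simp add: raag_pi_coset)
qed simp

lemma raag_pi_gen:
  assumes "v \<in> vertices K"
  shows "raag_gen K v \<in> carrier (raag K)" and "raag_pi K (raag_gen K v) = 1"
proof -
  have v: "[(v, True)] \<in> carrier (free_group (vertices K))"
    using assms by (simp add: free_group_def)
  then show "raag_gen K v \<in> carrier (raag K)"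
    by (auto simp: raag_gen_def raag_def presented_group_def FactGroup_def RCOSETS_def)
  show "raag_pi K (raag_gen K v) = 1"
    using raag_pi_coset[OF v] by (simp add: raag_gen_def exponent_sum_def)
qed

lemma subgroup_raag_H: "subgroup (raag_H K) (raag K)"
proof -
  interpret group_hom "raag K" integer_group "raag_pi K"
    by (simp add: group_hom_def group_hom_axioms_def group_raag raag_pi_hom)
  show ?thesis unfolding raag_H_def by (rule subgroup_kernel)
qed

lemma subgroup_raag_Gamma: "subgroup (raag_Gamma K n) (raag K)"
proof -
  interpret group_hom "raag K" integer_group "raag_pi K"
    by (simp add: group_hom_def group_hom_axioms_def group_raag raag_pi_hom)
  have inv: "inv\<^bsub>integer_group\<^esub> z = - z" for z
    by (rule group.inv_equality[OF group_integer_group]) (auto simp: integer_group_def)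
  show ?thesis
  proof (rule G.subgroupI)
    show "raag_Gamma K n \<noteq> {}"
      using hom_one by (auto simp: raag_Gamma_def intro!: exI[of _ "\<one>\<^bsub>raag K\<^esub>"])
  next
    fix g h assume "g \<in> raag_Gamma K n" "h \<in> raag_Gamma K n"
    then show "g \<otimes>\<^bsub>raag K\<^esub> h \<in> raag_Gamma K n"
      by (auto simp: raag_Gamma_def)
  qed (auto simp: raag_Gamma_def inv)
qed

end

theory Submission
  imports Defs "HOL-Algebra.Bij" "HOL-Library.Z2"
begin

text \<open>If \<open>H\<close> has a presentation with \<open>d\<close> generators and \<open>m\<close> relators, then the semidirect product
  \<open>\<Gamma>\<^sub>n = H \<rtimes> \<langle>(e r)^n\<rangle>\<close> has one with \<open>d + 1\<close> generators and \<open>m + d\<close> relators, so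
  the deficiencies are bounded. If the graph is a tree, then \<open>H\<close> is free.

  Otherwise some edge \<open>x0 y0\<close> is not a bridge. The square of this edge contributes \<open>n\<close> cells to
  the covering complex with fundamental group \<open>\<Gamma>\<^sub>n\<close>, and since the edge lies on a cycle these
  cells give \<open>n\<close> independent classes in \<open>H\<^sup>2(\<Gamma>\<^sub>n; \<int>/2)\<close>, whereas \<open>\<Gamma>\<^sub>n\<close> is generated by a number
  of elements that does not depend on \<open>n\<close>. Hence relators minus generators is at least \<open>n\<close> minus
  a constant. Classes are handled as functions on the relators of an arbitrary presentation.\<close>

subsection \<open>Free groups and their universal property\<close>

text \<open>The infimum runs over all presentations of \<Gamma>_n, so the lower bound must be
  uniform in an unknown presentation with d generators and relator set R. Hopf's estimate |R| - d
  \<ge> dim H^2 - dim H^1 over Z/2 is used in the form n + d \<le> |R| + |S|, with S a generating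
  set of \<Gamma>_n: pairs of a class and a homomorphism from the free group to Z/2 inject into
  pairs of a function on R and a function on S. With coefficients Z/2, orientations disappear and
  linear algebra reduces to counting finite sets of functions.

  The absence of triangles makes the square complex of the Artin group two-dimensional: no cube
  imposes a condition, so any n-periodic function q of the height, put on the squares of x0 y0, is a
  cocycle. A potential for it on the Cayley graph can be written down explicitly. A cycle through
  the edge keeps the class nonzero: if the class vanished, a function on the vertices would be
  constant along the rest of the cycle and yet jump by q across x0 y0.\<close>

lemma subgroup_preimage:
  assumes "group G" "group H" "h \<in> hom G H" "subgroup S H"
  shows "subgroup {g \<in> carrier G. h g \<in> S} G"
proof -
  interpret group_hom G H h
    using assms by (simp add: group_hom_def group_hom_axioms_def)
  interpret S: subgroup S H by fact
  show ?thesis by (rule G.subgroupI) auto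
qed

lemma free_group_simps [simp]:
  "\<one>\<^bsub>free_group X\<^esub> = []"
  "u \<otimes>\<^bsub>free_group X\<^esub> v = foldr reduced_cons u v"
  by (simp_all add: free_group_def)

lemma free_group_carrier_iff:
  "w \<in> carrier (free_group X) \<longleftrightarrow> reduced w \<and> fst ` set w \<subseteq> X"
  by (simp add: free_group_def)

lemma letter_in_free_group [simp]:
  "[l] \<in> carrier (free_group X) \<longleftrightarrow> fst l \<in> X"
  by (simp add: free_group_carrier_iff)

lemma one_in_free_group [simp]: "[] \<in> carrier (free_group X)"
  by (simp add: free_group_carrier_iff)

lemma foldr_reduced_cons_closed [simp]:
  "u \<in> carrier (free_group X) \<Longrightarrow> v \<in> carrier (free_group X)
    \<Longrightarrow> foldr reduced_cons u v \<in> carrier (free_group X)"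
  using monoid.m_closed[OF group.is_monoid[OF group_free_group]] by fastforce

lemma inv_letter:
  assumes "fst l \<in> X"
  shows "inv\<^bsub>free_group X\<^esub> [l] = [letter_inv l]"
  by (rule group.inv_equality[OF group_free_group])
    (use assms in \<open>auto simp: letter_inv_def\<close>)

text \<open>The step uses \<open>reduced_cons\<close>, which is left multiplication by a letter, so
  homomorphisms apply to it without tracking reducedness.\<close>

lemma free_group_induct [consumes 1, case_names Nil Cons]:
  assumes "w \<in> carrier (free_group X)"
    and "P []"
    and "\<And>l w. fst l \<in> X \<Longrightarrow> w \<in> carrier (free_group X) \<Longrightarrow> P w \<Longrightarrow> P (reduced_cons l w)"
  shows "P w"
  using assms(1)
proof (induction w)
  case (Cons l w)
  then have "w \<in> carrier (free_group X)" "fst l \<in> X" "reduced (l # w)"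
    by (auto simp: free_group_carrier_iff dest: reduced_tl)
  moreover have "reduced_cons l w = l # w"
    using \<open>reduced (l # w)\<close> by (cases w) auto
  ultimately show ?case using Cons.IH assms(3) by metis
qed (rule assms(2))

lemma subgroup_free_group_eqI:
  assumes S: "subgroup S (free_group X)" and gen: "\<And>x. x \<in> X \<Longrightarrow> [(x, True)] \<in> S"
    and w: "w \<in> carrier (free_group X)"
  shows "w \<in> S"
proof -
  interpret S: subgroup S "free_group X" by fact
  have letter: "[l] \<in> S" if "fst l \<in> X" for l
  proof (cases "snd l")
    case True
    then have "l = (fst l, True)" by (simp add: prod_eq_iff)
    then show ?thesis using gen[OF that] by simp
  next
    case False
    then have l: "[letter_inv (fst l, True)] = [l]" by (simp add: letter_inv_def prod_eq_iff)
    have "inv\<^bsub>free_group X\<^esub> [(fst l, True)] \<in> S"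
      using gen[OF that] by (rule S.m_inv_closed)
    moreover have "inv\<^bsub>free_group X\<^esub> [(fst l, True)] = [l]"
      unfolding l[symmetric] by (rule inv_letter) (simp add: that)
    ultimately show ?thesis by simp
  qed
  show ?thesis using w
  proof (induction rule: free_group_induct)
    case Nil
    then show ?case using S.one_closed by simp
  next
    case (Cons l w)
    then show ?case using S.m_closed[OF letter[OF Cons(1)] Cons(3)] by simp
  qed
qed

lemma hom_free_group_eqI:
  assumes "group G" "f \<in> hom (free_group X) G" "g \<in> hom (free_group X) G"
    and "\<And>x. x \<in> X \<Longrightarrow> f [(x, True)] = g [(x, True)]"
    and "w \<in> carrier (free_group X)"
  shows "f w = g w"
proof -
  interpret f: group_hom "free_group X" G f
    using assms by (simp add: group_hom_def group_hom_axioms_def group_free_group)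
  interpret g: group_hom "free_group X" G g
    using assms by (simp add: group_hom_def group_hom_axioms_def group_free_group)
  have "subgroup {w \<in> carrier (free_group X). f w = g w} (free_group X)"
    using f.hom_one g.hom_one
    by (intro f.G.subgroupI) (auto simp: f.hom_mult[simplified] g.hom_mult[simplified]
        intro!: exI[of _ "[]"])
  from subgroup_free_group_eqI[OF this _ assms(5)] show ?thesis
    using assms(4) by auto
qed

definition free_lift :: "('g, 'm) monoid_scheme \<Rightarrow> ('a \<Rightarrow> 'g) \<Rightarrow> 'a word \<Rightarrow> 'g" where
  "free_lift G f w =
     foldr (\<lambda>l acc. (if snd l then f (fst l) else inv\<^bsub>G\<^esub> f (fst l)) \<otimes>\<^bsub>G\<^esub> acc) w \<one>\<^bsub>G\<^esub>"

text \<open>The fold makes sense on unreduced words too. A cancellation removes a factor x x^-1 and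
  leaves its value unchanged (\<open>step\<close>); multiplicativity follows by induction on the
  left factor.\<close>

lemma free_lift_hom:
  assumes "group G" and f: "f \<in> X \<rightarrow> carrier G"
  shows "free_lift G f \<in> hom (free_group X) G"
proof -
  interpret group G by fact
  have f': "x \<in> X \<Longrightarrow> f x \<in> carrier G" for x using f by auto
  have closed: "free_lift G f w \<in> carrier G" if "fst ` set w \<subseteq> X" for w
    using that by (induction w) (auto simp: free_lift_def f')
  have lift_Cons: "free_lift G f (l # w) =
      (if snd l then f (fst l) else inv\<^bsub>G\<^esub> f (fst l)) \<otimes>\<^bsub>G\<^esub> free_lift G f w" for l w
    by (simp add: free_lift_def)
  have step: "free_lift G f (reduced_cons l w) = free_lift G f (l # w)"
    if "fst l \<in> X" "fst ` set w \<subseteq> X" for l w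
  proof (cases w)
    case (Cons m w')
    then show ?thesis
      using that closed[of w'] f'[of "fst l"]
      by (cases "m = letter_inv l") (simp_all add: lift_Cons letter_inv_def m_assoc[symmetric])
  qed simp
  have sub: "fst ` set (foldr reduced_cons u v) \<subseteq> X"
    if "fst ` set u \<subseteq> X" "fst ` set v \<subseteq> X" for u v
    using set_foldr_reduced_cons[of u v] that by blast
  have mult: "free_lift G f (foldr reduced_cons u v) = free_lift G f u \<otimes>\<^bsub>G\<^esub> free_lift G f v"
    if "fst ` set u \<subseteq> X" "fst ` set v \<subseteq> X" for u v
    using that
  proof (induction u)
    case Nil
    then show ?case using closed by (simp add: free_lift_def)
  next
    case (Cons l u)
    then show ?case
      using sub[of u v] closed[of u] closed[of v] f'[of "fst l"]
      by (simp add: step lift_Cons m_assoc)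
  qed
  show ?thesis
    by (rule homI) (auto simp: free_group_carrier_iff intro!: closed mult)
qed

lemma free_lift_gen [simp]:
  "group G \<Longrightarrow> f x \<in> carrier G \<Longrightarrow> free_lift G f [(x, True)] = f x"
  by (simp add: free_lift_def group.is_monoid monoid.r_one)

section \<open>Normal closures, and presentations as surjections from a free group\<close>

lemma normal_closure_minimal: "N \<lhd> G \<Longrightarrow> R \<subseteq> N \<Longrightarrow> normal_closure G R \<subseteq> N"
  by (auto simp: normal_closure_def)

lemma normal_closure_superset: "R \<subseteq> normal_closure G R"
  by (auto simp: normal_closure_def)

lemma normal_closure_subset_kernel:
  assumes "group G" "group H" "h \<in> hom G H" "R \<subseteq> kernel G H h"
  shows "normal_closure G R \<subseteq> kernel G H h"
proof -
  interpret group_hom G H h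
    using assms by (simp add: group_hom_def group_hom_axioms_def)
  show ?thesis using normal_closure_minimal[OF normal_kernel assms(4)] .
qed

text \<open>\<open>presented_group\<close> only gives an abstract isomorphism type; lifting elements
  and evaluating cocycles on relators require the surjection \<open>p\<close> itself.\<close>

definition presents :: "('a word \<Rightarrow> 'g) \<Rightarrow> 'a set \<Rightarrow> 'a word set \<Rightarrow> ('g, 'm) monoid_scheme \<Rightarrow> bool" where
  "presents p X R G \<longleftrightarrow> p \<in> hom (free_group X) G \<and> p ` carrier (free_group X) = carrier G \<and>
     kernel (free_group X) G p = normal_closure (free_group X) R"

lemma presents_imp_iso:
  assumes "group G" "presents p X R G"
  shows "G \<cong> presented_group X R"
proof -
  interpret group_hom "free_group X" G p
    using assms by (simp add: presents_def group_hom_def group_hom_axioms_def group_free_group)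
  have "presented_group X R \<cong> G"
    using FactGroup_iso assms(2) by (simp add: presents_def presented_group_def)
  moreover have "group (presented_group X R)"
    unfolding presented_group_def using normal.factorgroup_is_group[OF normal_kernel] assms(2)
    by (simp add: presents_def)
  ultimately show ?thesis by (simp add: group.iso_sym)
qed

lemma presents_presented_group:
  assumes "R \<subseteq> carrier (free_group X)"
  shows "presents (\<lambda>w. normal_closure (free_group X) R #>\<^bsub>free_group X\<^esub> w) X R (presented_group X R)"
proof -
  let ?F = "free_group X" and ?N = "normal_closure (free_group X) R"
  interpret F: group ?F by (rule group_free_group)
  interpret normal ?N ?F by (rule normal_closure_normal[OF group_free_group assms])
  have sub: "subgroup ?N ?F" by (rule subgroup_axioms)
  have one: "\<one>\<^bsub>presented_group X R\<^esub> = ?N" by (simp add: presented_group_def FactGroup_def)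
  have "kernel ?F (presented_group X R) (\<lambda>w. ?N #>\<^bsub>?F\<^esub> w) = ?N"
    unfolding kernel_def one using F.coset_join1[OF _ _ sub] F.coset_join2[OF _ sub] subset by blast
  then show ?thesis
    using r_coset_hom_Mod
    by (auto simp: presents_def presented_group_def FactGroup_def RCOSETS_def)
qed

lemma iso_imp_presents:
  assumes "group G" "R \<subseteq> carrier (free_group X)" "G \<cong> presented_group X R"
  shows "\<exists>p. presents p X R G"
proof -
  let ?F = "free_group X" and ?P = "presented_group X R"
  define q where "q = (\<lambda>w. normal_closure ?F R #>\<^bsub>?F\<^esub> w)"
  have q: "presents q X R ?P" unfolding q_def by (rule presents_presented_group[OF assms(2)])
  have P: "group ?P" by (rule group_presented_group[OF assms(2)])
  have "?P \<cong> G" using assms P by (simp add: group.iso_sym)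
  then obtain i where i: "i \<in> iso ?P G" by (auto simp: is_iso_def)
  then have ih: "i \<in> hom ?P G" and inj: "inj_on i (carrier ?P)" and im: "i ` carrier ?P = carrier G"
    by (auto simp: iso_def bij_betw_def)
  interpret i: group_hom ?P G i using assms P ih by (simp add: group_hom_def group_hom_axioms_def)
  interpret q: group_hom ?F ?P q
    using P q by (simp add: presents_def group_hom_def group_hom_axioms_def group_free_group)
  have "i (q w) = \<one>\<^bsub>G\<^esub> \<longleftrightarrow> q w = \<one>\<^bsub>?P\<^esub>" if "w \<in> carrier ?F" for w
    using inj that by (metis i.G.one_closed i.hom_one inj_onD q.hom_closed)
  then have "kernel ?F G (i \<circ> q) = kernel ?F ?P q" by (auto simp: kernel_def)
  moreover have "i \<circ> q \<in> hom ?F G" using q.homh ih by (rule hom_compose)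
  ultimately have "presents (i \<circ> q) X R G"
    using q im unfolding presents_def by (auto simp flip: image_image)
  then show ?thesis by blast
qed

lemma is_finite_presentation_iff:
  assumes "group G"
  shows "is_finite_presentation G d R \<longleftrightarrow>
    finite R \<and> R \<subseteq> carrier (free_group {..<d}) \<and> (\<exists>p. presents p {..<d} R G)"
  unfolding is_finite_presentation_def
  using iso_imp_presents[OF assms] presents_imp_iso[OF assms] by blast

context group
begin

lemma mult_inv_cancel:
  "x \<in> carrier G \<Longrightarrow> y \<in> carrier G \<Longrightarrow> x \<otimes> (inv x \<otimes> y) = y"
  "x \<in> carrier G \<Longrightarrow> y \<in> carrier G \<Longrightarrow> inv x \<otimes> (x \<otimes> y) = y"
  by (simp_all flip: m_assoc)

lemmas word_simps = m_assoc inv_mult_group mult_inv_cancel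

lemma commute_inv:
  assumes "x \<in> carrier G" "y \<in> carrier G" "x \<otimes> y = y \<otimes> x"
  shows "inv x \<otimes> y = y \<otimes> inv x"
proof -
  have "inv x \<otimes> y = inv x \<otimes> (y \<otimes> x) \<otimes> inv x" using assms(1,2) by (simp add: word_simps)
  also have "\<dots> = y \<otimes> inv x" using assms by (simp add: word_simps flip: assms(3))
  finally show ?thesis .
qed

text \<open>Every integer power of \<open>t\<close> conjugates \<open>B\<close> into itself, so
  powers of \<open>t\<close> can be moved to the right of elements of \<open>B\<close>. Invariance
  under conjugation by \<open>t\<close> alone would not give invariance under its inverse.\<close>

lemma subgroup_mult_powers:
  assumes "subgroup B G" and t: "t \<in> carrier G"
    and conj_pos: "\<And>b. b \<in> B \<Longrightarrow> t \<otimes> b \<otimes> inv t \<in> B"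
    and conj_neg: "\<And>b. b \<in> B \<Longrightarrow> inv t \<otimes> b \<otimes> t \<in> B"
  shows "subgroup {b \<otimes> t [^] k | b (k::int). b \<in> B} G"
proof -
  interpret B: subgroup B G by fact
  have Bc: "b \<in> B \<Longrightarrow> b \<in> carrier G" for b using B.subset by auto
  have conj_pow: "t [^] k \<otimes> b \<otimes> inv (t [^] k) \<in> B" if b: "b \<in> B" for b and k :: int
  proof (induction k rule: int_induct[where k = 0])
    case base
    then show ?case using b Bc by simp
  next
    case (step1 i)
    have "t [^] (i + 1) \<otimes> b \<otimes> inv (t [^] (i + 1)) = t \<otimes> (t [^] i \<otimes> b \<otimes> inv (t [^] i)) \<otimes> inv t"
      using t Bc[OF b] by (simp add: int_pow_mult add.commute[of i] word_simps)
    then show ?case using conj_pos[OF step1(2)] by simp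
  next
    case (step2 i)
    have "t [^] (-1 + i) \<otimes> b \<otimes> inv (t [^] (-1 + i)) = inv t \<otimes> (t [^] i \<otimes> b \<otimes> inv (t [^] i)) \<otimes> t"
      using t Bc[OF b]
      by (simp add: int_pow_mult int_pow_neg word_simps del: add_uminus_conv_diff uminus_add_conv_diff)
    then show ?case using conj_neg[OF step2(2)] by simp
  qed
  let ?S = "{b \<otimes> t [^] k | b (k::int). b \<in> B}"
  show ?thesis
  proof (rule subgroupI)
    show "?S \<subseteq> carrier G" using t Bc by auto
    show "?S \<noteq> {}" using B.one_closed by blast
    fix x assume "x \<in> ?S"
    then obtain b and k :: int where b: "b \<in> B" "x = b \<otimes> t [^] k" by auto
    have "inv x = (t [^] (-k) \<otimes> inv b \<otimes> inv (t [^] (-k))) \<otimes> t [^] (-k)"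
      using b Bc[OF b(1)] t by (simp add: int_pow_neg word_simps)
    moreover have "t [^] (-k) \<otimes> inv b \<otimes> inv (t [^] (-k)) \<in> B"
      using b by (intro conj_pow) auto
    ultimately show "inv x \<in> ?S" by blast
    fix y assume "y \<in> ?S"
    then obtain b' and k' :: int where b': "b' \<in> B" "y = b' \<otimes> t [^] k'" by auto
    have "x \<otimes> y = b \<otimes> (t [^] k \<otimes> b' \<otimes> inv (t [^] k)) \<otimes> t [^] (k + k')"
      using b b' Bc[OF b(1)] Bc[OF b'(1)] t by (simp add: int_pow_mult word_simps)
    moreover have "b \<otimes> (t [^] k \<otimes> b' \<otimes> inv (t [^] k)) \<in> B"
      using b b' conj_pow by auto
    ultimately show "x \<otimes> y \<in> ?S" by blast
  qed
qed

end

subsection \<open>Right-angled Artin groups\<close>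

locale raag_complex =
  fixes K :: "'a set set"
begin

abbreviation "V \<equiv> vertices K"
abbreviation "F \<equiv> free_group V"
abbreviation "N \<equiv> normal_closure F (raag_relators K)"
abbreviation "A \<equiv> raag K"
abbreviation "\<mu> \<equiv> \<lambda>w. N #>\<^bsub>F\<^esub> w"
abbreviation "e \<equiv> raag_gen K"
abbreviation "ht \<equiv> raag_pi K"

sublocale F: group F by (rule group_free_group)
sublocale A: group A by (rule group_raag)
sublocale pi: group_hom A integer_group ht
  by (simp add: group_hom_def group_hom_axioms_def group_raag raag_pi_hom)

lemma presents_raag: "presents \<mu> V (raag_relators K) A"
  unfolding raag_def by (rule presents_presented_group[OF raag_relators_subset])

sublocale mu: group_hom F A \<mu>
  using presents_raag
  by (simp add: group_hom_def group_hom_axioms_def group_raag group_free_group presents_def)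

lemma mu_surj: "g \<in> carrier A \<Longrightarrow> \<exists>w\<in>carrier F. \<mu> w = g"
  using presents_raag unfolding presents_def by (metis (no_types, lifting) imageE)

lemma mu_kernel: "kernel F A \<mu> = N"
  using presents_raag unfolding presents_def by blast

lemma mu_gen: "\<mu> [(v, True)] = e v"
  by (simp add: raag_gen_def)

lemma gen_closed [simp]: "v \<in> V \<Longrightarrow> e v \<in> carrier A"
  by (rule raag_pi_gen)

lemma mu_inv_gen: "v \<in> V \<Longrightarrow> \<mu> [(v, False)] = inv\<^bsub>A\<^esub> e v"
  using mu.hom_inv[of "[(v, True)]"] by (simp add: inv_letter letter_inv_def mu_gen)

lemma adjacentD: "adjacent K u v \<Longrightarrow> u \<in> V" "adjacent K u v \<Longrightarrow> v \<in> V" "adjacent K u v \<Longrightarrow> u \<noteq> v"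
  by (auto simp: adjacent_def vertices_def)

lemma adjacent_sym: "adjacent K u v \<Longrightarrow> adjacent K v u"
  by (auto simp: adjacent_def insert_commute)

lemma ht_mult [simp]: "g \<in> carrier A \<Longrightarrow> h \<in> carrier A \<Longrightarrow> ht (g \<otimes>\<^bsub>A\<^esub> h) = ht g + ht h"
  using pi.hom_mult by simp

lemma ht_one [simp]: "ht \<one>\<^bsub>A\<^esub> = 0"
  using pi.hom_one by simp

lemma ht_inv [simp]: "g \<in> carrier A \<Longrightarrow> ht (inv\<^bsub>A\<^esub> g) = - ht g"
  using ht_mult[of "inv\<^bsub>A\<^esub> g" g] by (simp del: ht_mult)

lemma ht_gen [simp]: "v \<in> V \<Longrightarrow> ht (e v) = 1"
  by (rule raag_pi_gen)

lemma ht_nat_pow [simp]: "g \<in> carrier A \<Longrightarrow> ht (g [^]\<^bsub>A\<^esub> (k::nat)) = int k * ht g"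
  by (induction k) (auto simp: algebra_simps)

lemma ht_int_pow [simp]: "g \<in> carrier A \<Longrightarrow> ht (g [^]\<^bsub>A\<^esub> (k::int)) = k * ht g"
  by (cases k rule: int_cases2) (auto simp: int_pow_int A.int_pow_neg)

lemma gen_commute:
  assumes "adjacent K u v"
  shows "e u \<otimes>\<^bsub>A\<^esub> e v = e v \<otimes>\<^bsub>A\<^esub> e u"
proof -
  have uv: "u \<in> V" "v \<in> V" "u \<noteq> v" using adjacentD[OF assms] by auto
  have "[(u, True), (v, True), (u, False), (v, False)] \<in> raag_relators K"
    using assms by (auto simp: raag_relators_def)
  then have "[(u, True), (v, True), (u, False), (v, False)] \<in> kernel F A \<mu>"
    by (subst mu_kernel) (rule subsetD[OF normal_closure_superset])
  then have "\<mu> [(u, True), (v, True), (u, False), (v, False)] = \<one>\<^bsub>A\<^esub>"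
    by (simp add: kernel_def)
  also have "[(u, True), (v, True), (u, False), (v, False)] =
      [(u, True)] \<otimes>\<^bsub>F\<^esub> ([(v, True)] \<otimes>\<^bsub>F\<^esub> ([(u, False)] \<otimes>\<^bsub>F\<^esub> [(v, False)]))"
    using uv by (simp add: letter_inv_def)
  also have "\<mu> \<dots> = e u \<otimes>\<^bsub>A\<^esub> (e v \<otimes>\<^bsub>A\<^esub> (inv\<^bsub>A\<^esub> e u \<otimes>\<^bsub>A\<^esub> inv\<^bsub>A\<^esub> e v))"
    using uv by (simp only: mu.hom_mult F.m_closed letter_in_free_group fst_conv mu_gen mu_inv_gen)
  also have "\<dots> = (e u \<otimes>\<^bsub>A\<^esub> e v) \<otimes>\<^bsub>A\<^esub> inv\<^bsub>A\<^esub> (e v \<otimes>\<^bsub>A\<^esub> e u)"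
    using uv by (simp add: A.m_assoc A.inv_mult_group)
  finally show ?thesis
    using uv by (metis A.inv_closed A.inv_equality A.inv_inv A.m_closed gen_closed)
qed

text \<open>Von Dyck's theorem for \<open>A\<close>. It yields the retraction onto the free group on
  a link and, for trees, the action on a free group.\<close>

lemma raag_universal:
  assumes T: "group T" and f: "f \<in> V \<rightarrow> carrier T"
    and comm: "\<And>u v. adjacent K u v \<Longrightarrow> f u \<otimes>\<^bsub>T\<^esub> f v = f v \<otimes>\<^bsub>T\<^esub> f u"
  obtains h where "h \<in> hom A T" "\<And>v. v \<in> V \<Longrightarrow> h (e v) = f v"
proof -
  interpret T: group T by fact
  interpret l: group_hom F T "free_lift T f"
    using T free_lift_hom[OF T f] by (simp add: group_hom_def group_hom_axioms_def group_free_group)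
  have f': "v \<in> V \<Longrightarrow> f v \<in> carrier T" for v using f by auto
  have lT: "free_lift T f [(v, True)] = f v" if "v \<in> V" for v
    using f'[OF that] T by simp
  have lF: "free_lift T f [(v, False)] = inv\<^bsub>T\<^esub> f v" if "v \<in> V" for v
    using l.hom_inv[of "[(v, True)]"] that by (simp add: inv_letter letter_inv_def lT)
  have "raag_relators K \<subseteq> kernel F T (free_lift T f)"
  proof
    fix w assume w: "w \<in> raag_relators K"
    then obtain u v where uv: "adjacent K u v" "w = [(u, True), (v, True), (u, False), (v, False)]"
      by (auto simp: raag_relators_def)
    have V: "u \<in> V" "v \<in> V" "u \<noteq> v" using adjacentD[OF uv(1)] by auto
    have "w = [(u, True)] \<otimes>\<^bsub>F\<^esub> ([(v, True)] \<otimes>\<^bsub>F\<^esub> ([(u, False)] \<otimes>\<^bsub>F\<^esub> [(v, False)]))"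
      using V uv(2) by (simp add: letter_inv_def)
    then have "free_lift T f w = f u \<otimes>\<^bsub>T\<^esub> (f v \<otimes>\<^bsub>T\<^esub> (inv\<^bsub>T\<^esub> f u \<otimes>\<^bsub>T\<^esub> inv\<^bsub>T\<^esub> f v))"
      using V by (simp only: l.hom_mult F.m_closed letter_in_free_group fst_conv lT lF)
    also have "\<dots> = (f u \<otimes>\<^bsub>T\<^esub> f v) \<otimes>\<^bsub>T\<^esub> inv\<^bsub>T\<^esub> (f v \<otimes>\<^bsub>T\<^esub> f u)"
      using V f' by (simp add: T.m_assoc T.inv_mult_group)
    also have "\<dots> = \<one>\<^bsub>T\<^esub>" using comm[OF uv(1)] V f' by simp
    finally show "w \<in> kernel F T (free_lift T f)"
      using w raag_relators_subset by (auto simp: kernel_def)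
  qed
  then have "N \<subseteq> kernel F T (free_lift T f)"
    by (rule normal_closure_subset_kernel[OF group_free_group T l.homh])
  from l.FactGroup_universal_kernel[OF normal_closure_normal[OF group_free_group raag_relators_subset] this]
  obtain h where "h \<in> hom A T" "\<And>x. x \<in> carrier F \<Longrightarrow> h (\<mu> x) = free_lift T f x"
    by (auto simp: raag_def presented_group_def)
  with that show ?thesis using lT by (simp add: raag_gen_def)
qed

lemma raag_subgroup_eqI:
  assumes S: "subgroup S A" and gen: "\<And>v. v \<in> V \<Longrightarrow> e v \<in> S" and g: "g \<in> carrier A"
  shows "g \<in> S"
proof -
  obtain w where w: "w \<in> carrier F" "\<mu> w = g" using mu_surj[OF g] by auto
  have "subgroup {w \<in> carrier F. \<mu> w \<in> S} F"
    by (rule subgroup_preimage[OF F.group_axioms A.group_axioms mu.homh S])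
  from subgroup_free_group_eqI[OF this _ w(1)] show ?thesis
    using w(2) gen mu_gen by auto
qed

section \<open>The kernel of the height map and its generators\<close>

lemma H_iff: "g \<in> raag_H K \<longleftrightarrow> g \<in> carrier A \<and> ht g = 0"
  by (auto simp: raag_H_def kernel_def)

lemma H_eq_Inter_Gamma: "raag_H K = (\<Inter>n\<in>{1..}. raag_Gamma K n)"
proof (intro equalityI subsetI)
  fix g assume g: "g \<in> (\<Inter>n\<in>{1..}. raag_Gamma K n)"
  then have dvd: "int (Suc k) dvd ht g" for k
    by (auto simp: raag_Gamma_def simp del: of_nat_Suc)
  \<comment> \<open>The modulus is chosen larger than the absolute value of \<open>ht g\<close>, so
    it divides \<open>ht g\<close> only if that is 0.\<close>
  have "ht g = 0"
    using dvd[of "nat \<bar>ht g\<bar>"] dvd_imp_le_int[of "ht g" "int (Suc (nat \<bar>ht g\<bar>))"] by fastforce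
  then show "g \<in> raag_H K" using g by (auto simp: H_iff raag_Gamma_def)
qed (auto simp: H_iff raag_Gamma_def)

text \<open>The Dicks-Leary generators of the Bestvina-Brady group H, one for each oriented
  edge.\<close>

abbreviation "edge_elts \<equiv> {e u \<otimes>\<^bsub>A\<^esub> inv\<^bsub>A\<^esub> e v | u v. adjacent K u v}"

lemma generate_edge_elts: "generate A edge_elts \<subseteq> raag_H K"
proof (rule A.generate_subgroup_incl[OF _ subgroup_raag_H])
  show "edge_elts \<subseteq> raag_H K" using adjacentD by (auto simp: H_iff)
qed

text \<open>An edge element \<open>e u (e v)\<inverse>\<close> commutes with \<open>e u\<close>, so conjugating it by \<open>e r\<close> is the same as
  conjugating it by \<open>e r (e u)\<inverse>\<close>, which is a product of edge elements along a path.\<close>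

lemma edge_elts_generate:
  assumes conn: "connected_complex K" and r: "r \<in> V" and g: "g \<in> carrier A"
  obtains b where "b \<in> generate A edge_elts" "g = b \<otimes>\<^bsub>A\<^esub> e r [^]\<^bsub>A\<^esub> ht g"
proof -
  let ?B = "generate A edge_elts"
  have incl: "edge_elts \<subseteq> carrier A" using adjacentD by auto
  then interpret B: subgroup ?B A by (rule A.generate_is_subgroup)
  \<comment> \<open>The second form serves conjugation by the inverse of \<open>e r\<close>. Across
    a single edge it is again an edge element because the two generators commute, so both forms
    propagate along a path.\<close>
  have pos: "e u \<otimes>\<^bsub>A\<^esub> inv\<^bsub>A\<^esub> e v \<in> ?B \<and> inv\<^bsub>A\<^esub> e u \<otimes>\<^bsub>A\<^esub> e v \<in> ?B"
    if u: "u \<in> V" and v: "v \<in> V" for u v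
  proof -
    have "(adjacent K)\<^sup>*\<^sup>* u v" using conn u v by (auto simp: connected_complex_def)
    then show ?thesis
    proof (induction rule: rtranclp_induct)
      case base
      then show ?case using u B.one_closed by simp
    next
      case (step y z)
      have V: "y \<in> V" "z \<in> V" using adjacentD[OF step(2)] by auto
      have yz: "e y \<otimes>\<^bsub>A\<^esub> inv\<^bsub>A\<^esub> e z \<in> ?B" using step(2) by (auto intro: generate.incl)
      have zy: "e z \<otimes>\<^bsub>A\<^esub> inv\<^bsub>A\<^esub> e y \<in> ?B" using adjacent_sym[OF step(2)] by (auto intro: generate.incl)
      have "inv\<^bsub>A\<^esub> e y \<otimes>\<^bsub>A\<^esub> e z = e z \<otimes>\<^bsub>A\<^esub> inv\<^bsub>A\<^esub> e y"
        using gen_commute[OF step(2)] V by (simp add: A.commute_inv)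
      with zy have zy': "inv\<^bsub>A\<^esub> e y \<otimes>\<^bsub>A\<^esub> e z \<in> ?B" by simp
      have "e u \<otimes>\<^bsub>A\<^esub> inv\<^bsub>A\<^esub> e z = (e u \<otimes>\<^bsub>A\<^esub> inv\<^bsub>A\<^esub> e y) \<otimes>\<^bsub>A\<^esub> (e y \<otimes>\<^bsub>A\<^esub> inv\<^bsub>A\<^esub> e z)"
        using u V by (simp add: A.word_simps)
      moreover have "inv\<^bsub>A\<^esub> e u \<otimes>\<^bsub>A\<^esub> e z =
          (inv\<^bsub>A\<^esub> e u \<otimes>\<^bsub>A\<^esub> e y) \<otimes>\<^bsub>A\<^esub> (inv\<^bsub>A\<^esub> e y \<otimes>\<^bsub>A\<^esub> e z)"
        using u V by (simp add: A.word_simps)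
      ultimately show ?case
        using B.m_closed[OF conjunct1[OF step(3)] yz] B.m_closed[OF conjunct2[OF step(3)] zy']
        by simp
    qed
  qed
  let ?c = "\<lambda>x b. x \<otimes>\<^bsub>A\<^esub> b \<otimes>\<^bsub>A\<^esub> inv\<^bsub>A\<^esub> x"
  have conj: "subgroup {b \<in> carrier A. ?c x b \<in> ?B} A" if x: "x \<in> carrier A" for x
  proof -
    have "(\<lambda>b. ?c x b) \<in> hom A A"
      using x by (intro homI) (auto simp: A.word_simps)
    then show ?thesis using subgroup_preimage[OF A.group_axioms A.group_axioms _ B.subgroup_axioms] by blast
  qed
  have conj_pos: "?c (e r) b \<in> ?B" if b: "b \<in> ?B" for b
  proof -
    have "?B \<subseteq> {b \<in> carrier A. ?c (e r) b \<in> ?B}"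
    proof (rule A.generate_subgroup_incl[OF _ conj])
      show "edge_elts \<subseteq> {b \<in> carrier A. ?c (e r) b \<in> ?B}"
      proof clarify
        fix u v assume uv: "adjacent K u v"
        have V: "u \<in> V" "v \<in> V" using adjacentD[OF uv] by auto
        have eq: "?c (e r) (e u \<otimes>\<^bsub>A\<^esub> inv\<^bsub>A\<^esub> e v) =
            (e r \<otimes>\<^bsub>A\<^esub> inv\<^bsub>A\<^esub> e u) \<otimes>\<^bsub>A\<^esub> (e u \<otimes>\<^bsub>A\<^esub> (e u \<otimes>\<^bsub>A\<^esub> inv\<^bsub>A\<^esub> e v)) \<otimes>\<^bsub>A\<^esub> inv\<^bsub>A\<^esub> e r"
          using V r by (simp add: A.word_simps)
        have comm: "e u \<otimes>\<^bsub>A\<^esub> (e u \<otimes>\<^bsub>A\<^esub> inv\<^bsub>A\<^esub> e v) = (e u \<otimes>\<^bsub>A\<^esub> inv\<^bsub>A\<^esub> e v) \<otimes>\<^bsub>A\<^esub> e u"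
          using A.commute_inv[OF _ _ gen_commute[OF adjacent_sym[OF uv]]] V by (simp add: A.m_assoc)
        have "?c (e r) (e u \<otimes>\<^bsub>A\<^esub> inv\<^bsub>A\<^esub> e v) =
            (e r \<otimes>\<^bsub>A\<^esub> inv\<^bsub>A\<^esub> e u) \<otimes>\<^bsub>A\<^esub> (e u \<otimes>\<^bsub>A\<^esub> inv\<^bsub>A\<^esub> e v) \<otimes>\<^bsub>A\<^esub> (e u \<otimes>\<^bsub>A\<^esub> inv\<^bsub>A\<^esub> e r)"
          unfolding eq comm using V r by (simp add: A.word_simps)
        moreover have "e u \<otimes>\<^bsub>A\<^esub> inv\<^bsub>A\<^esub> e v \<in> ?B" using uv by (auto intro: generate.incl)
        then have "(e r \<otimes>\<^bsub>A\<^esub> inv\<^bsub>A\<^esub> e u) \<otimes>\<^bsub>A\<^esub> (e u \<otimes>\<^bsub>A\<^esub> inv\<^bsub>A\<^esub> e v) \<otimes>\<^bsub>A\<^esub> (e u \<otimes>\<^bsub>A\<^esub> inv\<^bsub>A\<^esub> e r) \<in> ?B"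
          using pos V r by (intro B.m_closed[OF B.m_closed]) auto
        ultimately have "?c (e r) (e u \<otimes>\<^bsub>A\<^esub> inv\<^bsub>A\<^esub> e v) \<in> ?B" by (simp only:)
        then show "e u \<otimes>\<^bsub>A\<^esub> inv\<^bsub>A\<^esub> e v \<in> carrier A \<and> ?c (e r) (e u \<otimes>\<^bsub>A\<^esub> inv\<^bsub>A\<^esub> e v) \<in> ?B"
          using V by simp
      qed
    qed (use r in simp)
    then show ?thesis using b by blast
  qed
  have conj_neg: "?c (inv\<^bsub>A\<^esub> e r) b \<in> ?B" if b: "b \<in> ?B" for b
  proof -
    have "?B \<subseteq> {b \<in> carrier A. ?c (inv\<^bsub>A\<^esub> e r) b \<in> ?B}"
    proof (rule A.generate_subgroup_incl[OF _ conj])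
      show "edge_elts \<subseteq> {b \<in> carrier A. ?c (inv\<^bsub>A\<^esub> e r) b \<in> ?B}"
      proof clarify
        fix u v assume uv: "adjacent K u v"
        have V: "u \<in> V" "v \<in> V" using adjacentD[OF uv] by auto
        have comm: "e u \<otimes>\<^bsub>A\<^esub> (e u \<otimes>\<^bsub>A\<^esub> inv\<^bsub>A\<^esub> e v) = (e u \<otimes>\<^bsub>A\<^esub> inv\<^bsub>A\<^esub> e v) \<otimes>\<^bsub>A\<^esub> e u"
          using A.commute_inv[OF _ _ gen_commute[OF adjacent_sym[OF uv]]] V by (simp add: A.m_assoc)
        have "(inv\<^bsub>A\<^esub> e r \<otimes>\<^bsub>A\<^esub> e u) \<otimes>\<^bsub>A\<^esub> (e u \<otimes>\<^bsub>A\<^esub> inv\<^bsub>A\<^esub> e v) \<otimes>\<^bsub>A\<^esub> (inv\<^bsub>A\<^esub> e u \<otimes>\<^bsub>A\<^esub> e r)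
            = inv\<^bsub>A\<^esub> e r \<otimes>\<^bsub>A\<^esub> (e u \<otimes>\<^bsub>A\<^esub> (e u \<otimes>\<^bsub>A\<^esub> inv\<^bsub>A\<^esub> e v)) \<otimes>\<^bsub>A\<^esub> inv\<^bsub>A\<^esub> e u \<otimes>\<^bsub>A\<^esub> e r"
          using V r by (simp add: A.word_simps)
        also have "\<dots> = inv\<^bsub>A\<^esub> e r \<otimes>\<^bsub>A\<^esub> ((e u \<otimes>\<^bsub>A\<^esub> inv\<^bsub>A\<^esub> e v) \<otimes>\<^bsub>A\<^esub> e u) \<otimes>\<^bsub>A\<^esub> inv\<^bsub>A\<^esub> e u \<otimes>\<^bsub>A\<^esub> e r"
          by (simp only: comm)
        also have "\<dots> = ?c (inv\<^bsub>A\<^esub> e r) (e u \<otimes>\<^bsub>A\<^esub> inv\<^bsub>A\<^esub> e v)"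
          using V r by (simp add: A.word_simps)
        finally have eq: "(inv\<^bsub>A\<^esub> e r \<otimes>\<^bsub>A\<^esub> e u) \<otimes>\<^bsub>A\<^esub> (e u \<otimes>\<^bsub>A\<^esub> inv\<^bsub>A\<^esub> e v) \<otimes>\<^bsub>A\<^esub> (inv\<^bsub>A\<^esub> e u \<otimes>\<^bsub>A\<^esub> e r)
            = ?c (inv\<^bsub>A\<^esub> e r) (e u \<otimes>\<^bsub>A\<^esub> inv\<^bsub>A\<^esub> e v)" .
        moreover have "e u \<otimes>\<^bsub>A\<^esub> inv\<^bsub>A\<^esub> e v \<in> ?B" using uv by (auto intro: generate.incl)
        then have "(inv\<^bsub>A\<^esub> e r \<otimes>\<^bsub>A\<^esub> e u) \<otimes>\<^bsub>A\<^esub> (e u \<otimes>\<^bsub>A\<^esub> inv\<^bsub>A\<^esub> e v) \<otimes>\<^bsub>A\<^esub> (inv\<^bsub>A\<^esub> e u \<otimes>\<^bsub>A\<^esub> e r) \<in> ?B"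
          using pos V r by (intro B.m_closed[OF B.m_closed]) auto
        ultimately have "?c (inv\<^bsub>A\<^esub> e r) (e u \<otimes>\<^bsub>A\<^esub> inv\<^bsub>A\<^esub> e v) \<in> ?B" by (simp only:)
        then show "e u \<otimes>\<^bsub>A\<^esub> inv\<^bsub>A\<^esub> e v \<in> carrier A \<and> ?c (inv\<^bsub>A\<^esub> e r) (e u \<otimes>\<^bsub>A\<^esub> inv\<^bsub>A\<^esub> e v) \<in> ?B"
          using V by simp
      qed
    qed (use r in simp)
    then show ?thesis using b by blast
  qed
  define S where "S = {b \<otimes>\<^bsub>A\<^esub> e r [^]\<^bsub>A\<^esub> k | b (k::int). b \<in> ?B}"
  have Bc: "b \<in> ?B \<Longrightarrow> b \<in> carrier A" for b using B.subset by auto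
  have "subgroup S A"
    unfolding S_def using conj_pos conj_neg r
    by (intro A.subgroup_mult_powers B.subgroup_axioms) auto
  moreover have "e v \<in> S" if v: "v \<in> V" for v
  proof -
    have "e v = e v \<otimes>\<^bsub>A\<^esub> inv\<^bsub>A\<^esub> e r \<otimes>\<^bsub>A\<^esub> e r [^]\<^bsub>A\<^esub> (1::int)"
      using v r by (simp add: A.m_assoc A.int_pow_1)
    then show ?thesis using pos[OF v r] unfolding S_def by blast
  qed
  ultimately have "g \<in> S" using g raag_subgroup_eqI by blast
  then obtain b and k :: int where b: "b \<in> ?B" "g = b \<otimes>\<^bsub>A\<^esub> e r [^]\<^bsub>A\<^esub> k" by (auto simp: S_def)
  have "ht b = 0" using b(1) generate_edge_elts by (auto simp: H_iff)
  then have "ht g = k" unfolding b(2) using Bc[OF b(1)] r by simp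
  then show ?thesis using b that by simp
qed

lemma H_generated:
  assumes "connected_complex K"
  shows "raag_H K = generate A edge_elts"
proof (cases "V = {}")
  case True
  have "g = \<one>\<^bsub>A\<^esub>" if "g \<in> carrier A" for g
    using raag_subgroup_eqI[OF A.triv_subgroup _ that] True by blast
  then show ?thesis using generate_edge_elts generate.one by (fastforce simp: H_iff)
next
  case False
  then obtain r where r: "r \<in> V" by auto
  have "g \<in> generate A edge_elts" if g: "g \<in> raag_H K" for g
  proof -
    have "g \<in> carrier A" "ht g = 0" using g by (auto simp: H_iff)
    from edge_elts_generate[OF assms r this(1)] obtain b
      where "b \<in> generate A edge_elts" "g = b \<otimes>\<^bsub>A\<^esub> e r [^]\<^bsub>A\<^esub> ht g" .
    moreover have "b \<in> carrier A" using calculation(1) generate_edge_elts by (auto simp: H_iff)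
    ultimately show ?thesis using \<open>ht g = 0\<close> by simp
  qed
  then show ?thesis using generate_edge_elts by auto
qed

end

subsection \<open>Presentations of extensions by the integers\<close>

lemma free_group_mono: "X \<subseteq> Y \<Longrightarrow> carrier (free_group X) \<subseteq> carrier (free_group Y)"
  unfolding free_group_carrier_iff subset_iff by blast

text \<open>\<open>G\<close> is the semidirect product of \<open>H\<close> and \<open>\<langle>t\<rangle>\<close>. Only the relators expressing \<open>t x t\<inverse>\<close> as
  words in the generators of \<open>H\<close> are needed: since conjugation by \<open>t\<close> is surjective on \<open>H\<close>, they
  also express \<open>t\<inverse> x t\<close> as such words.\<close>

lemma is_finite_presentation_semidirect:
  assumes G: "group G" and H: "H \<lhd> G" and t: "t \<in> carrier G"
    and G_eq: "\<And>g. g \<in> carrier G \<Longrightarrow> \<exists>h\<in>H. \<exists>k::int. g = h \<otimes>\<^bsub>G\<^esub> t [^]\<^bsub>G\<^esub> k"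
    and t_pow: "\<And>k::int. t [^]\<^bsub>G\<^esub> k \<in> H \<Longrightarrow> k = 0"
    and pres: "is_finite_presentation (G\<lparr>carrier := H\<rparr>) d R"
  obtains R' where "is_finite_presentation G (Suc d) R'" "card R' \<le> card R + d"
proof -
  interpret G: group G by fact
  interpret H: normal H G by fact
  let ?B = "free_group {..<d}" and ?E = "free_group {..<Suc d}"
  interpret B: group ?B by (rule group_free_group)
  interpret E: group ?E by (rule group_free_group)
  have HG: "group (G\<lparr>carrier := H\<rparr>)" by (rule H.subgroup_is_group[OF G])
  obtain p where p: "presents p {..<d} R (G\<lparr>carrier := H\<rparr>)" and R: "finite R" "R \<subseteq> carrier ?B"
    using pres by (auto simp: is_finite_presentation_iff[OF HG])
  have p_im: "p ` carrier ?B = H" using p by (simp add: presents_def)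
  then have pH: "u \<in> carrier ?B \<Longrightarrow> p u \<in> H" for u by auto
  then have pG: "u \<in> carrier ?B \<Longrightarrow> p u \<in> carrier G" for u using H.subset by auto
  have p_hom: "p \<in> hom ?B G" using p pG unfolding presents_def hom_def by auto
  interpret p: group_hom ?B G p
    using p_hom by (simp add: group_hom_def group_hom_axioms_def G group_free_group)
  have p_ker: "p u = \<one>\<^bsub>G\<^esub> \<longleftrightarrow> u \<in> normal_closure ?B R" if "u \<in> carrier ?B" for u
  proof -
    have "kernel ?B (G\<lparr>carrier := H\<rparr>) p = normal_closure ?B R" using p by (simp add: presents_def)
    then show ?thesis using that by (auto simp: kernel_def)
  qed
  have BE: "carrier ?B \<subseteq> carrier ?E" by (rule free_group_mono) auto
  \<comment> \<open>Conjugation by \<open>s\<close> preserves the normal subgroup \<open>H\<close>,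
    and freeness lifts it to an endomorphism of the free group. This is applied to \<open>t\<close>
    and to its inverse.\<close>
  have lift: "\<exists>\<omega>\<in>hom ?B ?B. \<forall>u\<in>carrier ?B. p (\<omega> u) = s \<otimes>\<^bsub>G\<^esub> p u \<otimes>\<^bsub>G\<^esub> inv\<^bsub>G\<^esub> s"
    if s: "s \<in> carrier G" for s
  proof -
    have conj: "s \<otimes>\<^bsub>G\<^esub> p u \<otimes>\<^bsub>G\<^esub> inv\<^bsub>G\<^esub> s \<in> p ` carrier ?B" if "u \<in> carrier ?B" for u
      unfolding p_im using H.inv_op_closed2[OF s pH[OF that]] .
    then have "\<exists>w. w \<in> carrier ?B \<and> p w = s \<otimes>\<^bsub>G\<^esub> p [(i, True)] \<otimes>\<^bsub>G\<^esub> inv\<^bsub>G\<^esub> s" if "i < d" for i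
      using imageE[OF conj[of "[(i, True)]"]] that by (metis fst_conv lessThan_iff letter_in_free_group)
    then obtain f where f: "\<And>i. i < d \<Longrightarrow> f i \<in> carrier ?B"
        "\<And>i. i < d \<Longrightarrow> p (f i) = s \<otimes>\<^bsub>G\<^esub> p [(i, True)] \<otimes>\<^bsub>G\<^esub> inv\<^bsub>G\<^esub> s"
      by metis
    have hom: "free_lift ?B f \<in> hom ?B ?B"
      using f(1) by (intro free_lift_hom group_free_group) auto
    have "p (free_lift ?B f u) = s \<otimes>\<^bsub>G\<^esub> p u \<otimes>\<^bsub>G\<^esub> inv\<^bsub>G\<^esub> s" if "u \<in> carrier ?B" for u
    proof (rule hom_free_group_eqI[OF G _ _ _ that])
      show "(\<lambda>u. p (free_lift ?B f u)) \<in> hom ?B G"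
        using hom_compose[OF hom p_hom] by (simp add: comp_def)
      show "(\<lambda>u. s \<otimes>\<^bsub>G\<^esub> p u \<otimes>\<^bsub>G\<^esub> inv\<^bsub>G\<^esub> s) \<in> hom ?B G"
        using s pG p.hom_mult by (intro homI) (auto simp: G.word_simps)
    qed (use f in \<open>auto simp: group_free_group\<close>)
    with hom show ?thesis by blast
  qed
  obtain \<omega> where w_hom: "\<omega> \<in> hom ?B ?B"
    and w: "\<And>u. u \<in> carrier ?B \<Longrightarrow> p (\<omega> u) = t \<otimes>\<^bsub>G\<^esub> p u \<otimes>\<^bsub>G\<^esub> inv\<^bsub>G\<^esub> t"
    using lift[OF t] by blast
  obtain \<upsilon> where v_hom: "\<upsilon> \<in> hom ?B ?B"
    and v: "\<And>u. u \<in> carrier ?B \<Longrightarrow> p (\<upsilon> u) = inv\<^bsub>G\<^esub> t \<otimes>\<^bsub>G\<^esub> p u \<otimes>\<^bsub>G\<^esub> t"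
    using lift[of "inv\<^bsub>G\<^esub> t"] t by auto
  have wB: "u \<in> carrier ?B \<Longrightarrow> \<omega> u \<in> carrier ?B" for u using w_hom by (rule hom_in_carrier)
  have vB: "u \<in> carrier ?B \<Longrightarrow> \<upsilon> u \<in> carrier ?B" for u using v_hom by (rule hom_in_carrier)
  define P where "P = free_lift G (\<lambda>i. if i < d then p [(i, True)] else t)"
  have P_hom: "P \<in> hom ?E G"
    unfolding P_def using t pG by (intro free_lift_hom G) auto
  interpret P: group_hom ?E G P
    using P_hom by (simp add: group_hom_def group_hom_axioms_def G group_free_group)
  let ?t = "[(d, True)]"
  have tE: "?t \<in> carrier ?E" by simp
  have P_t: "P ?t = t" using t G by (simp add: P_def)
  have P_p: "P u = p u" if "u \<in> carrier ?B" for u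
  proof (rule hom_free_group_eqI[OF G _ p_hom _ that])
    show "P \<in> hom ?B G" using P_hom BE unfolding hom_def by auto
  qed (use pG G in \<open>auto simp: P_def\<close>)
  define rel where "rel i = ?t \<otimes>\<^bsub>?E\<^esub> [(i, True)] \<otimes>\<^bsub>?E\<^esub> inv\<^bsub>?E\<^esub> ?t \<otimes>\<^bsub>?E\<^esub> inv\<^bsub>?E\<^esub> \<omega> [(i, True)]" for i
  define R' where "R' = R \<union> rel ` {..<d}"
  have relE: "rel i \<in> carrier ?E" if "i < d" for i
    using that wB[of "[(i, True)]"] BE unfolding rel_def
    by (intro E.m_closed E.inv_closed) auto
  have R'E: "R' \<subseteq> carrier ?E" using R relE BE by (auto simp: R'_def)
  let ?Q = "presented_group {..<Suc d} R'"
  define \<kappa> where "\<kappa> = (\<lambda>w. normal_closure ?E R' #>\<^bsub>?E\<^esub> w)"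
  have k: "presents \<kappa> {..<Suc d} R' ?Q" unfolding \<kappa>_def by (rule presents_presented_group[OF R'E])
  have Q: "group ?Q" by (rule group_presented_group[OF R'E])
  interpret Q: group ?Q by (rule Q)
  interpret k: group_hom ?E ?Q \<kappa>
    using k Q by (simp add: presents_def group_hom_def group_hom_axioms_def group_free_group)
  have k_ker: "\<kappa> x = \<one>\<^bsub>?Q\<^esub> \<longleftrightarrow> x \<in> normal_closure ?E R'" if "x \<in> carrier ?E" for x
    using k that by (auto simp: presents_def kernel_def)
  have k_hom: "\<kappa> \<in> hom ?B ?Q" using k.homh BE unfolding hom_def by auto
  interpret kB: group_hom ?B ?Q \<kappa>
    using k_hom by (simp add: group_hom_def group_hom_axioms_def Q group_free_group)
  have kR: "\<kappa> r = \<one>\<^bsub>?Q\<^esub>" if "r \<in> R'" for r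
    using k_ker subsetD[OF R'E that] subsetD[OF normal_closure_superset that] by simp
  have "R \<subseteq> kernel ?B ?Q \<kappa>" using R kR by (auto simp: kernel_def R'_def)
  then have "normal_closure ?B R \<subseteq> kernel ?B ?Q \<kappa>"
    by (rule normal_closure_subset_kernel[OF group_free_group Q k_hom])
  then have k_p: "\<kappa> u = \<one>\<^bsub>?Q\<^esub>" if "u \<in> carrier ?B" "p u = \<one>\<^bsub>G\<^esub>" for u
    using p_ker that by (auto simp: kernel_def)
  \<comment> \<open>On words in the old generators \<kappa> factors through \<open>p\<close>; in
    effect \<open>H\<close> maps to \<open>?Q\<close>.\<close>
  have k_eq: "\<kappa> u = \<kappa> u'" if "u \<in> carrier ?B" "u' \<in> carrier ?B" "p u = p u'" for u u'
  proof -
    have "\<kappa> (u \<otimes>\<^bsub>?B\<^esub> inv\<^bsub>?B\<^esub> u') = \<one>\<^bsub>?Q\<^esub>"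
      by (rule k_p) (use that pG in \<open>simp_all only: p.hom_mult p.hom_inv B.m_closed B.inv_closed G.r_inv\<close>)
    then have "\<kappa> u \<otimes>\<^bsub>?Q\<^esub> inv\<^bsub>?Q\<^esub> \<kappa> u' = \<one>\<^bsub>?Q\<^esub>"
      using that by (simp only: kB.hom_mult kB.hom_inv B.inv_closed)
    then show ?thesis using that by (metis Q.inv_equality Q.inv_inv Q.inv_closed kB.hom_closed)
  qed
  let ?T = "\<kappa> ?t"
  have T: "?T \<in> carrier ?Q" using tE by (rule k.hom_closed)
  have conj_w: "?T \<otimes>\<^bsub>?Q\<^esub> \<kappa> u \<otimes>\<^bsub>?Q\<^esub> inv\<^bsub>?Q\<^esub> ?T = \<kappa> (\<omega> u)" if "u \<in> carrier ?B" for u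
  proof (rule hom_free_group_eqI[OF Q _ _ _ that])
    show "(\<lambda>u. ?T \<otimes>\<^bsub>?Q\<^esub> \<kappa> u \<otimes>\<^bsub>?Q\<^esub> inv\<^bsub>?Q\<^esub> ?T) \<in> hom ?B ?Q"
      using T kB.hom_closed kB.hom_mult by (intro homI) (auto simp: Q.word_simps)
    show "(\<lambda>u. \<kappa> (\<omega> u)) \<in> hom ?B ?Q"
      using hom_compose[OF w_hom k_hom] by (simp add: comp_def)
    fix i assume "i \<in> {..<d}"
    then have i: "i < d" by simp
    have x: "[(i, True)] \<in> carrier ?E" using i by simp
    have wx: "\<omega> [(i, True)] \<in> carrier ?E" using wB[of "[(i, True)]"] BE i by auto
    have "\<kappa> (rel i) = \<one>\<^bsub>?Q\<^esub>" using kR i by (auto simp: R'_def)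
    then have eq: "(?T \<otimes>\<^bsub>?Q\<^esub> \<kappa> [(i, True)] \<otimes>\<^bsub>?Q\<^esub> inv\<^bsub>?Q\<^esub> ?T) \<otimes>\<^bsub>?Q\<^esub> inv\<^bsub>?Q\<^esub> \<kappa> (\<omega> [(i, True)]) = \<one>\<^bsub>?Q\<^esub>"
      unfolding rel_def using tE x wx
      by (simp only: k.hom_mult k.hom_inv E.m_closed E.inv_closed)
    have c: "?T \<otimes>\<^bsub>?Q\<^esub> \<kappa> [(i, True)] \<otimes>\<^bsub>?Q\<^esub> inv\<^bsub>?Q\<^esub> ?T \<in> carrier ?Q"
      using T k.hom_closed[OF x] by simp
    show "?T \<otimes>\<^bsub>?Q\<^esub> \<kappa> [(i, True)] \<otimes>\<^bsub>?Q\<^esub> inv\<^bsub>?Q\<^esub> ?T = \<kappa> (\<omega> [(i, True)])"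
      using Q.inv_equality[OF eq] c k.hom_closed[OF wx] by simp
  qed
  \<comment> \<open>The words \<omega> (\<upsilon> u) and \<open>u\<close> agree under
    \<open>p\<close>, hence under \<kappa>. So \<open>conj_w\<close> at \<upsilon> u can be solved
    for conjugation by the inverse of \<open>?T\<close>.\<close>
  have conj_v: "inv\<^bsub>?Q\<^esub> ?T \<otimes>\<^bsub>?Q\<^esub> \<kappa> u \<otimes>\<^bsub>?Q\<^esub> ?T = \<kappa> (\<upsilon> u)" if u: "u \<in> carrier ?B" for u
  proof -
    have "p (\<omega> (\<upsilon> u)) = p u"
      using t pG[OF u] by (simp add: w[OF vB[OF u]] v[OF u] G.word_simps)
    then have "\<kappa> u = \<kappa> (\<omega> (\<upsilon> u))" using k_eq[OF wB[OF vB[OF u]] u] by simp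
    also have "\<dots> = ?T \<otimes>\<^bsub>?Q\<^esub> \<kappa> (\<upsilon> u) \<otimes>\<^bsub>?Q\<^esub> inv\<^bsub>?Q\<^esub> ?T" using conj_w[OF vB[OF u]] by simp
    finally show ?thesis using T kB.hom_closed[OF vB[OF u]] by (simp add: Q.word_simps)
  qed
  have kB: "subgroup (\<kappa> ` carrier ?B) ?Q" by (rule kB.img_is_subgroup)
  let ?S = "{b \<otimes>\<^bsub>?Q\<^esub> ?T [^]\<^bsub>?Q\<^esub> n | b (n::int). b \<in> \<kappa> ` carrier ?B}"
  have S: "subgroup ?S ?Q"
    using conj_w conj_v wB vB T by (intro Q.subgroup_mult_powers kB) auto
  have normal_form: "\<exists>u\<in>carrier ?B. \<exists>n::int. \<kappa> x = \<kappa> u \<otimes>\<^bsub>?Q\<^esub> ?T [^]\<^bsub>?Q\<^esub> n"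
    if x: "x \<in> carrier ?E" for x
  proof -
    have "x \<in> {x \<in> carrier ?E. \<kappa> x \<in> ?S}"
    proof (rule subgroup_free_group_eqI[OF _ _ x])
      show "subgroup {x \<in> carrier ?E. \<kappa> x \<in> ?S} ?E"
        by (rule subgroup_preimage[OF group_free_group Q k.homh S])
      fix i assume i: "i \<in> {..<Suc d}"
      have "\<kappa> [(i, True)] \<in> ?S"
      proof (cases "i < d")
        case True
        then have "\<kappa> [(i, True)] = \<kappa> [(i, True)] \<otimes>\<^bsub>?Q\<^esub> ?T [^]\<^bsub>?Q\<^esub> (0::int)" by simp
        moreover have "\<kappa> [(i, True)] \<in> \<kappa> ` carrier ?B" using True by simp
        ultimately show ?thesis by blast
      next
        case False
        then have "i = d" using i by simp
        then have "\<kappa> [(i, True)] = \<one>\<^bsub>?Q\<^esub> \<otimes>\<^bsub>?Q\<^esub> ?T [^]\<^bsub>?Q\<^esub> (1::int)" using T by (simp add: Q.int_pow_1)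
        moreover have "\<one>\<^bsub>?Q\<^esub> \<in> \<kappa> ` carrier ?B" using kB by (rule subgroup.one_closed)
        ultimately show ?thesis by blast
      qed
      then show "[(i, True)] \<in> {x \<in> carrier ?E. \<kappa> x \<in> ?S}" using i by simp
    qed
    then show ?thesis by blast
  qed
  have P_R': "R' \<subseteq> kernel ?E G P"
  proof -
    have "P r = \<one>\<^bsub>G\<^esub>" if "r \<in> R" for r
      using P_p p_ker subsetD[OF R(2) that] subsetD[OF normal_closure_superset that] by simp
    moreover have "P (rel i) = \<one>\<^bsub>G\<^esub>" if "i < d" for i
    proof -
      have x: "[(i, True)] \<in> carrier ?B" using that by simp
      have "P (rel i) = (P ?t \<otimes>\<^bsub>G\<^esub> P [(i, True)] \<otimes>\<^bsub>G\<^esub> inv\<^bsub>G\<^esub> P ?t) \<otimes>\<^bsub>G\<^esub> inv\<^bsub>G\<^esub> P (\<omega> [(i, True)])"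
        unfolding rel_def using tE subsetD[OF BE x] subsetD[OF BE wB[OF x]]
        by (simp only: P.hom_mult P.hom_inv E.m_closed E.inv_closed)
      also have "\<dots> = \<one>\<^bsub>G\<^esub>"
        using t pG[OF x] by (simp add: P_t P_p[OF x] P_p[OF wB[OF x]] w[OF x])
      finally show ?thesis .
    qed
    ultimately show ?thesis using R'E by (auto simp: kernel_def R'_def)
  qed
  then have ker1: "normal_closure ?E R' \<subseteq> kernel ?E G P"
    by (rule normal_closure_subset_kernel[OF group_free_group G P_hom])
  have P_k: "P x = P y" if "x \<in> carrier ?E" "y \<in> carrier ?E" "\<kappa> x = \<kappa> y" for x y
  proof -
    have "\<kappa> (x \<otimes>\<^bsub>?E\<^esub> inv\<^bsub>?E\<^esub> y) = \<one>\<^bsub>?Q\<^esub>"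
      using that k.hom_closed by (simp only: k.hom_mult k.hom_inv E.inv_closed Q.r_inv)
    then have "P (x \<otimes>\<^bsub>?E\<^esub> inv\<^bsub>?E\<^esub> y) = \<one>\<^bsub>G\<^esub>"
      using k_ker[OF E.m_closed[OF that(1) E.inv_closed[OF that(2)]]] ker1
      unfolding kernel_def by blast
    then have "P x \<otimes>\<^bsub>G\<^esub> inv\<^bsub>G\<^esub> P y = \<one>\<^bsub>G\<^esub>"
      using that by (simp only: P.hom_mult P.hom_inv E.inv_closed)
    then show ?thesis using that by (metis G.inv_equality G.inv_inv G.inv_closed P.hom_closed)
  qed
  \<comment> \<open>In normal form x becomes u t^n. Applying \<open>P\<close> gives p u t^n = 1, so
    t^n lies in \<open>H\<close> and n = 0 by \<open>t_pow\<close>; then p u = 1, and u is already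
    trivial in \<open>?Q\<close> by \<open>k_p\<close>.\<close>
  have ker2: "kernel ?E G P \<subseteq> normal_closure ?E R'"
  proof
    fix x assume "x \<in> kernel ?E G P"
    then have x: "x \<in> carrier ?E" "P x = \<one>\<^bsub>G\<^esub>" by (auto simp: kernel_def)
    obtain u and n :: int where u: "u \<in> carrier ?B" and n: "\<kappa> x = \<kappa> u \<otimes>\<^bsub>?Q\<^esub> ?T [^]\<^bsub>?Q\<^esub> n"
      using normal_form[OF x(1)] by blast
    have uE: "u \<in> carrier ?E" using u BE by auto
    have tn: "?t [^]\<^bsub>?E\<^esub> n \<in> carrier ?E" using tE by simp
    have "\<kappa> x = \<kappa> (u \<otimes>\<^bsub>?E\<^esub> ?t [^]\<^bsub>?E\<^esub> n)"
      using uE tE tn n by (simp only: k.hom_mult k.hom_int_pow)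
    then have "P x = P (u \<otimes>\<^bsub>?E\<^esub> ?t [^]\<^bsub>?E\<^esub> n)"
      by (rule P_k[OF x(1) E.m_closed[OF uE tn]])
    also have "\<dots> = p u \<otimes>\<^bsub>G\<^esub> t [^]\<^bsub>G\<^esub> n"
      using uE tE tn by (simp only: P.hom_mult P.hom_int_pow P_t P_p[OF u])
    finally have *: "p u \<otimes>\<^bsub>G\<^esub> t [^]\<^bsub>G\<^esub> n = \<one>\<^bsub>G\<^esub>" using x(2) by simp
    then have "p u = inv\<^bsub>G\<^esub> (t [^]\<^bsub>G\<^esub> n)" using t pG[OF u] by (simp add: G.inv_equality)
    then have "t [^]\<^bsub>G\<^esub> n = inv\<^bsub>G\<^esub> p u" using t by simp
    then have "t [^]\<^bsub>G\<^esub> n \<in> H" using H.m_inv_closed[OF pH[OF u]] by simp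
    then have "n = 0" by (rule t_pow)
    then have "p u = \<one>\<^bsub>G\<^esub>" using * pG[OF u] by simp
    then have "\<kappa> x = \<one>\<^bsub>?Q\<^esub>" using n k_p[OF u] \<open>n = 0\<close> by simp
    then show "x \<in> normal_closure ?E R'" using k_ker[OF x(1)] by simp
  qed
  have P_surj: "P ` carrier ?E = carrier G"
  proof
    show "carrier G \<subseteq> P ` carrier ?E"
    proof
      fix g assume "g \<in> carrier G"
      then obtain h and n :: int where h: "h \<in> H" "g = h \<otimes>\<^bsub>G\<^esub> t [^]\<^bsub>G\<^esub> n" using G_eq by blast
      obtain u where u: "u \<in> carrier ?B" "h = p u" using h(1) p_im by auto
      have uE: "u \<in> carrier ?E" using u BE by auto
      have tn: "?t [^]\<^bsub>?E\<^esub> n \<in> carrier ?E" using tE by simp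
      have "g = P (u \<otimes>\<^bsub>?E\<^esub> ?t [^]\<^bsub>?E\<^esub> n)"
        using uE tE tn h(2) u(2) by (simp only: P.hom_mult P.hom_int_pow P_t P_p[OF u(1)])
      then show "g \<in> P ` carrier ?E" using E.m_closed[OF uE tn] by blast
    qed
  qed (use P.hom_closed in auto)
  have "presents P {..<Suc d} R' G"
    using P_hom P_surj ker1 ker2 by (auto simp: presents_def)
  moreover have "finite R'" using R by (simp add: R'_def)
  ultimately have "is_finite_presentation G (Suc d) R'"
    using R'E is_finite_presentation_iff[OF G] by blast
  moreover have "card R' \<le> card R + d"
    unfolding R'_def by (intro order.trans[OF card_Un_le] add_left_mono)
      (use card_image_le[of "{..<d}" rel] in simp)
  ultimately show ?thesis by (rule that)
qed

subsection \<open>Trees\<close>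

text \<open>For an edge this says that it lies on no cycle. Trees enter as connected graphs all of
  whose edges are bridges.\<close>

definition is_bridge :: "'a set set \<Rightarrow> 'a \<Rightarrow> 'a \<Rightarrow> bool" where
  "is_bridge K x y \<longleftrightarrow> \<not> (\<lambda>u v. adjacent K u v \<and> {u, v} \<noteq> {x, y})\<^sup>*\<^sup>* x y"

context raag_complex
begin

text \<open>On a tree every group-valued edge cocycle is a coboundary. A connected vertex set
  \<open>U\<close> containing \<open>r\<close> grows one vertex at a time; the new vertex has a
  single neighbour in \<open>U\<close>, so its value is determined and no consistency condition
  arises.\<close>

lemma tree_potential:
  assumes fin: "finite V" and conn: "connected_complex K" and r: "r \<in> V"
    and bridges: "\<And>x y. adjacent K x y \<Longrightarrow> is_bridge K x y"
    and T: "group T"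
    and \<phi>: "\<And>u v. u \<in> V \<Longrightarrow> v \<in> V \<Longrightarrow> \<phi> u v \<in> carrier T"
    and \<phi>_inv: "\<And>u v. u \<in> V \<Longrightarrow> v \<in> V \<Longrightarrow> \<phi> v u = inv\<^bsub>T\<^esub> \<phi> u v"
  shows "\<exists>f. f r = \<one>\<^bsub>T\<^esub> \<and> (\<forall>v\<in>V. f v \<in> carrier T) \<and>
    (\<forall>u v. adjacent K u v \<longrightarrow> f v = \<phi> u v \<otimes>\<^bsub>T\<^esub> f u)"
proof -
  interpret T: group T by fact
  define R where "R = (\<lambda>U a b. adjacent K a b \<and> a \<in> U \<and> b \<in> U)"
  define good where "good = (\<lambda>U f. U \<subseteq> V \<and> r \<in> U \<and> (\<forall>a\<in>U. \<forall>b\<in>U. (R U)\<^sup>*\<^sup>* a b) \<and>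
     f r = \<one>\<^bsub>T\<^esub> \<and> (\<forall>v\<in>U. f v \<in> carrier T) \<and>
     (\<forall>u v. R U u v \<longrightarrow> f v = \<phi> u v \<otimes>\<^bsub>T\<^esub> f u))"
  have "\<exists>U f. good U f \<and> card U = Suc m" if "Suc m \<le> card V" for m
    using that
  proof (induction m)
    case 0
    have "good {r} (\<lambda>_. \<one>\<^bsub>T\<^esub>)"
      using r by (auto simp: good_def R_def dest: adjacentD)
    then show ?case by (intro exI[of _ "{r}"]) auto
  next
    case (Suc m)
    then obtain U f where good: "good U f" and card: "card U = Suc m" by auto
    have UV: "U \<subseteq> V" and rU: "r \<in> U" and Uconn: "\<And>a b. a \<in> U \<Longrightarrow> b \<in> U \<Longrightarrow> (R U)\<^sup>*\<^sup>* a b"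
      and fr: "f r = \<one>\<^bsub>T\<^esub>" and f: "\<And>v. v \<in> U \<Longrightarrow> f v \<in> carrier T"
      and step: "\<And>u v. R U u v \<Longrightarrow> f v = \<phi> u v \<otimes>\<^bsub>T\<^esub> f u"
      using good by (auto simp: good_def)
    have "\<exists>u v. u \<in> U \<and> v \<notin> U \<and> adjacent K u v"
    proof (rule ccontr)
      assume no: "\<not> ?thesis"
      have "w \<in> U" if "w \<in> V" for w
      proof -
        have "(adjacent K)\<^sup>*\<^sup>* r w" using conn r that by (auto simp: connected_complex_def)
        then show ?thesis by (induction rule: rtranclp_induct) (use rU no in auto)
      qed
      then have "card V \<le> card U" using UV by (metis subsetI subset_antisym order_refl)
      then show False using Suc(2) card by simp
    qed
    then obtain u v where u: "u \<in> U" and v: "v \<notin> U" and uv: "adjacent K u v" by blast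
    have vV: "v \<in> V" using adjacentD[OF uv] by simp
    have uV: "u \<in> V" using u UV by auto
    let ?U = "insert v U"
    let ?f = "f(v := \<phi> u v \<otimes>\<^bsub>T\<^esub> f u)"
    \<comment> \<open>A second neighbour of \<open>v\<close> would be joined to \<open>u\<close>
      inside \<open>U\<close>, closing a cycle through the edge from \<open>u\<close> to
      \<open>v\<close>.\<close>
    have only_u: "u' = u" if u': "u' \<in> U" and u'v: "adjacent K u' v" for u'
    proof (rule ccontr)
      assume neq: "u' \<noteq> u"
      let ?A = "\<lambda>a b. adjacent K a b \<and> {a, b} \<noteq> {u, v}"
      have "R U a b \<Longrightarrow> ?A a b" for a b using v by (auto simp: R_def)
      then have "?A\<^sup>*\<^sup>* u u'" using rtranclp_mono[of "R U" ?A] Uconn[OF u u'] by blast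
      moreover have "?A u' v" using u'v neq u v by auto
      ultimately have "?A\<^sup>*\<^sup>* u v" by (rule rtranclp.rtrancl_into_rtrancl)
      then show False using bridges[OF uv] by (simp add: is_bridge_def)
    qed
    have mono: "(R U)\<^sup>*\<^sup>* a b \<Longrightarrow> (R ?U)\<^sup>*\<^sup>* a b" for a b
      by (erule rtranclp_mono[THEN predicate2D, rotated]) (auto simp: R_def)
    have Ruv: "R ?U u v" "R ?U v u" using u uv adjacent_sym by (auto simp: R_def)
    have "(R ?U)\<^sup>*\<^sup>* a b" if "a \<in> ?U" "b \<in> ?U" for a b
    proof -
      have "(R ?U)\<^sup>*\<^sup>* a u" using that(1) Ruv mono[OF Uconn[OF _ u]] by auto
      moreover have "(R ?U)\<^sup>*\<^sup>* u b" using that(2) Ruv mono[OF Uconn[OF u]] by auto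
      ultimately show ?thesis by (rule rtranclp_trans)
    qed
    moreover have "?f b = \<phi> a b \<otimes>\<^bsub>T\<^esub> ?f a" if ab: "R ?U a b" for a b
    proof -
      have adj: "adjacent K a b" "a \<noteq> b" "a \<in> ?U" "b \<in> ?U"
        using ab adjacentD by (auto simp: R_def)
      consider "a \<in> U" "b \<in> U" | "a = v" "b \<in> U" | "a \<in> U" "b = v" using adj by auto
      then show ?thesis
      proof cases
        case 1
        then show ?thesis using step[of a b] adj v by (auto simp: R_def)
      next
        case 2
        then have "b = u" using only_u adjacent_sym adj by auto
        then show ?thesis using 2 u v f[OF u] uV vV \<phi>[OF uV vV]
          by (auto simp: \<phi>_inv[OF uV vV] T.mult_inv_cancel)
      next
        case 3
        then have "a = u" using only_u adj by auto
        then show ?thesis using 3 u v by auto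
      qed
    qed
    moreover have "?f w \<in> carrier T" if "w \<in> ?U" for w using that f[OF u] f \<phi>[OF uV vV] by auto
    moreover have "?f r = \<one>\<^bsub>T\<^esub>" using fr rU v by auto
    ultimately have "good ?U ?f"
      unfolding good_def using UV vV rU by blast
    moreover have "card ?U = Suc (Suc m)"
      using card v fin UV by (simp add: finite_subset)
    ultimately show ?case by blast
  qed
  moreover have "card V > 0" using fin r by (auto simp: card_gt_0_iff)
  ultimately obtain U f where good: "good U f" and "card U = card V"
    by (metis Suc_pred order_refl)
  then have "U = V" using fin by (simp add: good_def card_subset_eq)
  then show ?thesis using good adjacentD by (auto simp: good_def R_def)
qed

text \<open>For a tree, \<open>H\<close> is free on the \<open>y v = e v (e r)\<inverse>\<close>, \<open>v \<noteq> r\<close>. Writing \<open>\<tau>\<close> for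
  conjugation by \<open>e r\<close>, the relation for an edge \<open>uv\<close> reads \<open>\<tau> (y v) = (y u)\<inverse> (y v) \<tau> (y u)\<close>,
  which recursively determines an automorphism \<open>\<tau>\<close> of the free group. The Artin group then acts
  on the free group, \<open>e v\<close> acting as \<open>w \<mapsto> (y v) \<tau> w\<close>, so that \<open>H\<close> acts by left
  multiplications.\<close>

lemma tree_H_finitely_presentable:
  assumes fin: "finite V" and conn: "connected_complex K" and r: "r \<in> V"
    and bridges: "\<And>x y. adjacent K x y \<Longrightarrow> is_bridge K x y"
  shows "finitely_presentable (A\<lparr>carrier := raag_H K\<rparr>)"
proof -
  define d where "d = card (V - {r})"
  obtain h where h: "bij_betw h (V - {r}) {..<d}"
    using ex_bij_betw_finite_nat[of "V - {r}"] fin by (auto simp: d_def atLeast0LessThan)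
  define g where "g = inv_into (V - {r}) h"
  have gV: "g i \<in> V" "g i \<noteq> r" and hg: "h (g i) = i" if "i < d" for i
    using bij_betw_imp_surj_on[OF h] that inv_into_into[of i h "V - {r}"] f_inv_into_f[of i h "V - {r}"]
    by (auto simp: g_def)
  have gh: "g (h v) = v" and hd: "h v < d" if "v \<in> V" "v \<noteq> r" for v
    using h that by (auto simp: g_def bij_betw_def)
  let ?B = "free_group {..<d}"
  interpret B: group ?B by (rule group_free_group)
  define y where "y v = (if v = r then \<one>\<^bsub>?B\<^esub> else [(h v, True)])" for v
  have y: "v \<in> V \<Longrightarrow> y v \<in> carrier ?B" for v using hd by (auto simp: y_def)
  have y_r: "y r = \<one>\<^bsub>?B\<^esub>" by (simp add: y_def)
  have y_g: "i < d \<Longrightarrow> y (g i) = [(i, True)]" for i using gV hg by (simp add: y_def)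
  have reach: "(adjacent K)\<^sup>*\<^sup>* r v" if "v \<in> V" for v
    using conn r that by (auto simp: connected_complex_def)
  have "\<exists>f. f r = \<one>\<^bsub>?B\<^esub> \<and> (\<forall>v\<in>V. f v \<in> carrier ?B) \<and>
      (\<forall>u v. adjacent K u v \<longrightarrow> f v = inv\<^bsub>?B\<^esub> y u \<otimes>\<^bsub>?B\<^esub> y v \<otimes>\<^bsub>?B\<^esub> f u)"
    by (rule tree_potential[OF fin conn r bridges group_free_group])
      (use y in \<open>simp_all add: B.inv_mult_group del: free_group_simps\<close>)
  then obtain T where T_r: "T r = \<one>\<^bsub>?B\<^esub>" and T: "\<And>v. v \<in> V \<Longrightarrow> T v \<in> carrier ?B"
    and T_step: "\<And>u v. adjacent K u v \<Longrightarrow> T v = inv\<^bsub>?B\<^esub> y u \<otimes>\<^bsub>?B\<^esub> y v \<otimes>\<^bsub>?B\<^esub> T u"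
    by blast
  \<comment> \<open>The inverse \<sigma> of \<tau> must satisfy \<sigma> (y v) = \<sigma> (y u) (y
    v) (y u)^-1, which multiplies on the right. Since \<open>tree_potential\<close> multiplies on
    the left, \<open>S v\<close> is the inverse of \<sigma> (y v).\<close>
  have "\<exists>f. f r = \<one>\<^bsub>?B\<^esub> \<and> (\<forall>v\<in>V. f v \<in> carrier ?B) \<and>
      (\<forall>u v. adjacent K u v \<longrightarrow> f v = y u \<otimes>\<^bsub>?B\<^esub> inv\<^bsub>?B\<^esub> y v \<otimes>\<^bsub>?B\<^esub> f u)"
    by (rule tree_potential[OF fin conn r bridges group_free_group])
      (use y in \<open>simp_all add: B.inv_mult_group del: free_group_simps\<close>)
  then obtain S where S_r: "S r = \<one>\<^bsub>?B\<^esub>" and S: "\<And>v. v \<in> V \<Longrightarrow> S v \<in> carrier ?B"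
    and S_step: "\<And>u v. adjacent K u v \<Longrightarrow> S v = y u \<otimes>\<^bsub>?B\<^esub> inv\<^bsub>?B\<^esub> y v \<otimes>\<^bsub>?B\<^esub> S u"
    by blast
  have extend: "\<exists>\<tau>\<in>hom ?B ?B. \<forall>v\<in>V. \<tau> (y v) = f v"
    if f: "\<And>v. v \<in> V \<Longrightarrow> f v \<in> carrier ?B" and fr: "f r = \<one>\<^bsub>?B\<^esub>" for f
  proof
    show hom: "free_lift ?B (\<lambda>i. f (g i)) \<in> hom ?B ?B"
      using f gV by (intro free_lift_hom group_free_group) auto
    show "\<forall>v\<in>V. free_lift ?B (\<lambda>i. f (g i)) (y v) = f v"
    proof
      fix v assume v: "v \<in> V"
      show "free_lift ?B (\<lambda>i. f (g i)) (y v) = f v"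
        using v f[OF v] fr hom_one[OF hom group_free_group group_free_group]
        by (cases "v = r") (auto simp: y_def gh group_free_group)
    qed
  qed
  obtain \<tau> where \<tau>_hom: "\<tau> \<in> hom ?B ?B" and \<tau>_y: "\<And>v. v \<in> V \<Longrightarrow> \<tau> (y v) = T v"
    using extend[of T, OF T T_r] by blast
  have "\<exists>\<sigma>\<in>hom ?B ?B. \<forall>v\<in>V. \<sigma> (y v) = inv\<^bsub>?B\<^esub> S v"
    by (rule extend) (use S S_r in \<open>simp_all del: free_group_simps\<close>)
  then obtain \<sigma> where \<sigma>_hom: "\<sigma> \<in> hom ?B ?B" and \<sigma>_y: "\<And>v. v \<in> V \<Longrightarrow> \<sigma> (y v) = inv\<^bsub>?B\<^esub> S v"
    by blast
  interpret \<tau>: group_hom ?B ?B \<tau> using \<tau>_hom by (simp add: group_hom_def group_hom_axioms_def group_free_group)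
  interpret \<sigma>: group_hom ?B ?B \<sigma> using \<sigma>_hom by (simp add: group_hom_def group_hom_axioms_def group_free_group)
  note [simp del] = free_group_simps
  \<comment> \<open>Along a path from \<open>r\<close> the two recursions undo each other. Thus
    \<tau> and \<sigma> are mutually inverse, which will make each \<open>E v\<close> a
    bijection.\<close>
  have \<tau>_S: "\<tau> (inv\<^bsub>?B\<^esub> S v) = y v" if "v \<in> V" for v
    using reach[OF that]
  proof (induction rule: rtranclp_induct)
    case base
    then show ?case by (simp add: S_r y_r)
  next
    case (step u v)
    have uv: "u \<in> V" "v \<in> V" using adjacentD[OF step(2)] by auto
    have "inv\<^bsub>?B\<^esub> S v = inv\<^bsub>?B\<^esub> S u \<otimes>\<^bsub>?B\<^esub> y v \<otimes>\<^bsub>?B\<^esub> inv\<^bsub>?B\<^esub> y u"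
      unfolding S_step[OF step(2)] using uv y S by (simp add: B.word_simps)
    then have "\<tau> (inv\<^bsub>?B\<^esub> S v) = \<tau> (inv\<^bsub>?B\<^esub> S u) \<otimes>\<^bsub>?B\<^esub> T v \<otimes>\<^bsub>?B\<^esub> inv\<^bsub>?B\<^esub> T u"
      using uv y S by (simp only: \<tau>.hom_mult \<tau>.hom_inv \<tau>_y B.m_closed B.inv_closed)
    then show ?case
      unfolding step(3) T_step[OF step(2)] using uv y T by (simp add: B.word_simps)
  qed
  have \<sigma>_T: "\<sigma> (T v) = y v" if "v \<in> V" for v
    using reach[OF that]
  proof (induction rule: rtranclp_induct)
    case base
    then show ?case by (simp add: T_r y_r)
  next
    case (step u v)
    have uv: "u \<in> V" "v \<in> V" using adjacentD[OF step(2)] by auto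
    have "\<sigma> (T v) = inv\<^bsub>?B\<^esub> (inv\<^bsub>?B\<^esub> S u) \<otimes>\<^bsub>?B\<^esub> inv\<^bsub>?B\<^esub> S v \<otimes>\<^bsub>?B\<^esub> \<sigma> (T u)"
      unfolding T_step[OF step(2)] using uv y T
      by (simp only: \<sigma>.hom_mult \<sigma>.hom_inv \<sigma>_y B.m_closed B.inv_closed)
    then show ?case
      unfolding step(3) S_step[OF step(2)] using uv y S by (simp add: B.word_simps)
  qed
  have \<tau>\<sigma>: "\<tau> (\<sigma> w) = w" if "w \<in> carrier ?B" for w
  proof (rule hom_free_group_eqI[OF group_free_group _ _ _ that])
    show "(\<lambda>w. \<tau> (\<sigma> w)) \<in> hom ?B ?B" using hom_compose[OF \<sigma>_hom \<tau>_hom] by (simp add: comp_def)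
    show "(\<lambda>w. w) \<in> hom ?B ?B" by (simp add: hom_def)
    fix i assume "i \<in> {..<d}"
    then show "\<tau> (\<sigma> [(i, True)]) = [(i, True)]"
      using \<tau>_S[of "g i"] \<sigma>_y[of "g i"] gV y_g by simp
  qed
  have \<sigma>\<tau>: "\<sigma> (\<tau> w) = w" if "w \<in> carrier ?B" for w
  proof (rule hom_free_group_eqI[OF group_free_group _ _ _ that])
    show "(\<lambda>w. \<sigma> (\<tau> w)) \<in> hom ?B ?B" using hom_compose[OF \<tau>_hom \<sigma>_hom] by (simp add: comp_def)
    show "(\<lambda>w. w) \<in> hom ?B ?B" by (simp add: hom_def)
    fix i assume "i \<in> {..<d}"
    then show "\<sigma> (\<tau> [(i, True)]) = [(i, True)]"
      using \<sigma>_T[of "g i"] \<tau>_y[of "g i"] gV y_g by simp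
  qed
  let ?P = "BijGroup (carrier ?B)"
  interpret P: group ?P by (rule group_BijGroup)
  have P_mult: "x \<otimes>\<^bsub>?P\<^esub> z = (\<lambda>w\<in>carrier ?B. x (z w))" if "x \<in> carrier ?P" "z \<in> carrier ?P" for x z
    using that by (simp add: BijGroup_def compose_def)
  define E where "E v = (\<lambda>w\<in>carrier ?B. y v \<otimes>\<^bsub>?B\<^esub> \<tau> w)" for v
  have E: "E v \<in> carrier ?P" if v: "v \<in> V" for v
  proof -
    have "bij_betw (\<lambda>w. y v \<otimes>\<^bsub>?B\<^esub> \<tau> w) (carrier ?B) (carrier ?B)"
      by (rule bij_betw_byWitness[where f' = "\<lambda>w. \<sigma> (inv\<^bsub>?B\<^esub> y v \<otimes>\<^bsub>?B\<^esub> w)"])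
        (use v y in \<open>auto simp: \<tau>\<sigma> \<sigma>\<tau> B.mult_inv_cancel\<close>)
    then show ?thesis by (simp add: BijGroup_def Bij_def E_def)
  qed
  \<comment> \<open>After cancelling \<tau> (\<tau> w) this says (y u) (T v) = (y v) (T u), which is
    the recursion \<open>T_step\<close>.\<close>
  have E_comm: "E u \<otimes>\<^bsub>?P\<^esub> E v = E v \<otimes>\<^bsub>?P\<^esub> E u" if uv: "adjacent K u v" for u v
  proof -
    have V: "u \<in> V" "v \<in> V" using adjacentD[OF uv] by auto
    have "y u \<otimes>\<^bsub>?B\<^esub> \<tau> (y v \<otimes>\<^bsub>?B\<^esub> \<tau> w) = y v \<otimes>\<^bsub>?B\<^esub> \<tau> (y u \<otimes>\<^bsub>?B\<^esub> \<tau> w)" if "w \<in> carrier ?B" for w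
      using that V y T by (simp add: \<tau>_y T_step[OF uv] B.word_simps)
    then show ?thesis using V y by (auto simp: P_mult E) (auto simp: E_def intro!: restrict_ext)
  qed
  obtain \<Psi> where \<Psi>: "\<Psi> \<in> hom A ?P" and \<Psi>_e: "\<And>v. v \<in> V \<Longrightarrow> \<Psi> (e v) = E v"
    using raag_universal[OF P.is_group, of E] E E_comm by blast
  interpret \<Psi>: group_hom A ?P \<Psi>
    using \<Psi> by (simp add: group_hom_def group_hom_axioms_def group_raag group_BijGroup)
  define \<phi> where "\<phi> = free_lift A (\<lambda>i. e (g i) \<otimes>\<^bsub>A\<^esub> inv\<^bsub>A\<^esub> e r)"
  have \<phi>_hom: "\<phi> \<in> hom ?B A"
    unfolding \<phi>_def using r gV by (intro free_lift_hom group_raag) auto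
  interpret \<phi>: group_hom ?B A \<phi>
    using \<phi>_hom by (simp add: group_hom_def group_hom_axioms_def group_raag group_free_group)
  have \<phi>_y: "\<phi> (y v) = e v \<otimes>\<^bsub>A\<^esub> inv\<^bsub>A\<^esub> e r" if v: "v \<in> V" for v
  proof (cases "v = r")
    case True
    then show ?thesis using r by (simp add: y_r)
  next
    case False
    then show ?thesis using v r by (simp add: y_def \<phi>_def gh group_raag)
  qed
  define L where "L w = (\<lambda>z\<in>carrier ?B. w \<otimes>\<^bsub>?B\<^esub> z)" for w
  have L: "L w \<in> carrier ?P" if w: "w \<in> carrier ?B" for w
  proof -
    have "bij_betw (\<lambda>z. w \<otimes>\<^bsub>?B\<^esub> z) (carrier ?B) (carrier ?B)"
      by (rule bij_betw_byWitness[where f' = "\<lambda>z. inv\<^bsub>?B\<^esub> w \<otimes>\<^bsub>?B\<^esub> z"])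
        (use w in \<open>auto simp: B.mult_inv_cancel\<close>)
    then show ?thesis by (simp add: BijGroup_def Bij_def L_def)
  qed
  have L_hom: "L \<in> hom ?B ?P"
    using L by (intro homI) (auto simp: P_mult L_def B.m_assoc intro!: restrict_ext)
  have \<Psi>\<phi>: "\<Psi> (\<phi> w) = L w" if "w \<in> carrier ?B" for w
  proof (rule hom_free_group_eqI[OF group_BijGroup _ L_hom _ that])
    show "(\<lambda>w. \<Psi> (\<phi> w)) \<in> hom ?B ?P" using hom_compose[OF \<phi>_hom \<Psi>] by (simp add: comp_def)
    fix i assume "i \<in> {..<d}"
    then have i: "i < d" by simp
    have v: "g i \<in> V" using gV[OF i] by simp
    \<comment> \<open>As \<open>y r\<close> is the identity, \<open>E r\<close> is \<tau> itself,
      and dividing \<open>E v\<close> by it leaves left multiplication by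
      \<open>y v\<close>.\<close>
    have "L (y (g i)) \<otimes>\<^bsub>?P\<^esub> E r = E (g i)"
      using E[OF r] L[OF y[OF v]] y[OF v] by (auto simp: P_mult y_r E_def L_def intro!: restrict_ext)
    then have "L (y (g i)) = E (g i) \<otimes>\<^bsub>?P\<^esub> inv\<^bsub>?P\<^esub> E r"
      using E[OF r] E[OF v] L[OF y[OF v]] by (simp add: P.inv_solve_right)
    also have "\<dots> = \<Psi> (\<phi> (y (g i)))"
      using v r by (simp add: \<phi>_y \<Psi>_e)
    finally show "\<Psi> (\<phi> [(i, True)]) = L [(i, True)]" by (simp add: y_g[OF i])
  qed
  \<comment> \<open>Left multiplication by \<open>w\<close> sends the identity to \<open>w\<close>,
    so the action detects every element of the free group.\<close>
  have inj: "w = \<one>\<^bsub>?B\<^esub>" if w: "w \<in> carrier ?B" "\<phi> w = \<one>\<^bsub>A\<^esub>" for w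
  proof -
    have "L w = \<one>\<^bsub>?P\<^esub>" using \<Psi>\<phi>[OF w(1)] w(2) by simp
    then have "L w \<one>\<^bsub>?B\<^esub> = \<one>\<^bsub>?B\<^esub>" by (simp add: BijGroup_def)
    then show ?thesis using w(1) by (simp add: L_def)
  qed
  have im1: "\<phi> ` carrier ?B \<subseteq> raag_H K"
  proof
    fix x assume "x \<in> \<phi> ` carrier ?B"
    then obtain w where w: "w \<in> carrier ?B" "x = \<phi> w" by auto
    have "w \<in> {w \<in> carrier ?B. \<phi> w \<in> raag_H K}"
    proof (rule subgroup_free_group_eqI[OF _ _ w(1)])
      show "subgroup {w \<in> carrier ?B. \<phi> w \<in> raag_H K} ?B"
        by (rule subgroup_preimage[OF group_free_group group_raag \<phi>_hom subgroup_raag_H])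
      fix i assume "i \<in> {..<d}"
      then have "\<phi> [(i, True)] = e (g i) \<otimes>\<^bsub>A\<^esub> inv\<^bsub>A\<^esub> e r" "g i \<in> V"
        using \<phi>_y[of "g i"] gV[of i] y_g[of i] by auto
      then show "[(i, True)] \<in> {w \<in> carrier ?B. \<phi> w \<in> raag_H K}"
        using \<open>i \<in> {..<d}\<close> r by (simp add: H_iff)
    qed
    then show "x \<in> raag_H K" using w by simp
  qed
  have im2: "raag_H K \<subseteq> \<phi> ` carrier ?B"
    unfolding H_generated[OF conn]
  proof (rule A.generate_subgroup_incl[OF _ \<phi>.img_is_subgroup])
    show "edge_elts \<subseteq> \<phi> ` carrier ?B"
    proof clarify
      fix u v assume "adjacent K u v"
      then have uv: "u \<in> V" "v \<in> V" using adjacentD by auto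
      have "e u \<otimes>\<^bsub>A\<^esub> inv\<^bsub>A\<^esub> e v = \<phi> (y u \<otimes>\<^bsub>?B\<^esub> inv\<^bsub>?B\<^esub> y v)"
        using uv r y by (simp add: \<phi>_y A.word_simps)
      then show "e u \<otimes>\<^bsub>A\<^esub> inv\<^bsub>A\<^esub> e v \<in> \<phi> ` carrier ?B" using uv y by blast
    qed
  qed
  let ?H = "A\<lparr>carrier := raag_H K\<rparr>"
  have Hgrp: "group ?H" by (rule subgroup.subgroup_is_group[OF subgroup_raag_H group_raag])
  have \<phi>_H: "\<phi> \<in> hom ?B ?H" using \<phi>_hom im1 unfolding hom_def by auto
  have "kernel ?B ?H \<phi> = normal_closure ?B {}"
  proof
    have nc: "subgroup (normal_closure ?B {}) ?B"
      by (rule normal_imp_subgroup[OF normal_closure_normal[OF group_free_group]]) simp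
    show "kernel ?B ?H \<phi> \<subseteq> normal_closure ?B {}"
    proof
      fix w assume "w \<in> kernel ?B ?H \<phi>"
      then have "w = \<one>\<^bsub>?B\<^esub>" using inj by (simp add: kernel_def)
      then show "w \<in> normal_closure ?B {}" using subgroup.one_closed[OF nc] by simp
    qed
    show "normal_closure ?B {} \<subseteq> kernel ?B ?H \<phi>"
      by (rule normal_closure_subset_kernel[OF group_free_group Hgrp \<phi>_H]) simp
  qed
  then have "presents \<phi> {..<d} {} ?H"
    using \<phi>_H im1 im2 by (auto simp: presents_def)
  then have "is_finite_presentation ?H d {}"
    using is_finite_presentation_iff[OF Hgrp] by blast
  then show ?thesis unfolding finitely_presentable_def by blast
qed

end

subsection \<open>Weighted path sums\<close>

declare add_bit_eq_xor [simp del] \<comment> \<open>it would rewrite every sum to an \<open>XOR\<close>\<close>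

lemma bit_add_self [simp]: "x + x = (0::bit)"
  by (cases x) auto

lemma bit_add_self_left [simp]: "x + (x + y) = (y::bit)"
  by (simp flip: add.assoc)

lemma bit_add_eq_0_iff: "x + y = 0 \<longleftrightarrow> x = (y::bit)"
  by (cases x; cases y) auto

text \<open>The word \<open>w\<close> is read as a path starting at \<open>g\<close> in the Cayley graph of \<open>Q\<close>, and \<open>f g x\<close> is the
  weight modulo 2 of the edge from \<open>g\<close> to \<open>g (\<mu> x)\<close>.\<close>

fun path_sum :: "('g, 'm) monoid_scheme \<Rightarrow> ('a word \<Rightarrow> 'g) \<Rightarrow> ('g \<Rightarrow> 'a \<Rightarrow> bit) \<Rightarrow> 'g \<Rightarrow> 'a word \<Rightarrow> bit"
  where
  "path_sum Q \<mu> f g [] = 0"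
| "path_sum Q \<mu> f g (l # w) =
     f (if snd l then g else g \<otimes>\<^bsub>Q\<^esub> \<mu> [l]) (fst l) + path_sum Q \<mu> f (g \<otimes>\<^bsub>Q\<^esub> \<mu> [l]) w"

lemma path_sum_add:
  "path_sum Q \<mu> (\<lambda>g x. f g x + f' g x) g w = path_sum Q \<mu> f g w + path_sum Q \<mu> f' g w"
  by (induction w arbitrary: g) (auto simp: ac_simps)

lemma path_sum_const: "path_sum Q \<mu> (\<lambda>_. b) g w = (\<Sum>l\<leftarrow>w. b (fst l))"
  by (induction w arbitrary: g) auto

text \<open>Used with two targets: the Artin group, for \<Theta>, and the integers with the exponent
  sum, for \<alpha> and \<open>letter_sum\<close>.\<close>

locale path_hom = group_hom "free_group X" Q \<mu> for X and Q (structure) and \<mu>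
begin

lemma mu_letter: "fst l \<in> X \<Longrightarrow> \<mu> [l] \<in> carrier Q"
  by simp

lemma mu_letter_inv: "fst l \<in> X \<Longrightarrow> \<mu> [letter_inv l] = inv \<mu> [l]"
  using hom_inv[of "[l]"] by (simp add: inv_letter)

text \<open>A letter followed by its inverse runs along one edge and back, so the weight of that
  edge occurs twice and cancels modulo 2.\<close>

lemma path_sum_reduced_cons:
  assumes "fst l \<in> X" "g \<in> carrier Q"
  shows "path_sum Q \<mu> f g (reduced_cons l w) = path_sum Q \<mu> f g (l # w)"
proof (cases w)
  case (Cons m v)
  have "g \<otimes> \<mu> [l] \<otimes> inv \<mu> [l] = g" using assms by (simp add: H.m_assoc)
  then show ?thesis
    using assms Cons by (cases "snd l") (auto simp: mu_letter_inv, auto simp: letter_inv_def)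
qed simp

lemma mu_reduced_cons:
  assumes "fst l \<in> X" "w \<in> carrier (free_group X)"
  shows "\<mu> (reduced_cons l w) = \<mu> [l] \<otimes> \<mu> w"
  using hom_mult[of "[l]" w] assms by simp

text \<open>The second word is read from the endpoint of the first. This is the crossed-homomorphism
  rule of Fox derivatives.\<close>

lemma path_sum_mult:
  assumes "u \<in> carrier (free_group X)" "v \<in> carrier (free_group X)" "g \<in> carrier Q"
  shows "path_sum Q \<mu> f g (u \<otimes>\<^bsub>free_group X\<^esub> v) = path_sum Q \<mu> f g u + path_sum Q \<mu> f (g \<otimes> \<mu> u) v"
  using assms(1,3)
proof (induction arbitrary: g rule: free_group_induct)
  case Nil
  then show ?case using hom_one by simp
next
  case (Cons l u)
  have "foldr reduced_cons (reduced_cons l u) v = reduced_cons l (foldr reduced_cons u v)"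
    using assms(2) by (intro foldr_reduced_cons_step) (auto simp: free_group_carrier_iff)
  then have "path_sum Q \<mu> f g (reduced_cons l u \<otimes>\<^bsub>free_group X\<^esub> v) =
      path_sum Q \<mu> f g (l # (foldr reduced_cons u v))"
    using Cons by (simp add: path_sum_reduced_cons del: path_sum.simps)
  also have "\<dots> = path_sum Q \<mu> f g (l # u) + path_sum Q \<mu> f (g \<otimes> \<mu> [l] \<otimes> \<mu> u) v"
    using Cons(3)[of "g \<otimes> \<mu> [l]"] Cons(1,4) mu_letter[OF Cons(1)] by (simp add: add.assoc)
  also have "\<dots> = path_sum Q \<mu> f g (reduced_cons l u) + path_sum Q \<mu> f (g \<otimes> \<mu> (reduced_cons l u)) v"
    using Cons(1,2,4) mu_letter[OF Cons(1)]
    by (simp add: path_sum_reduced_cons mu_reduced_cons H.m_assoc del: path_sum.simps)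
  finally show ?case .
qed

lemma path_sum_inv:
  assumes "u \<in> carrier (free_group X)" "g \<in> carrier Q"
  shows "path_sum Q \<mu> f (g \<otimes> \<mu> u) (inv\<^bsub>free_group X\<^esub> u) = path_sum Q \<mu> f g u"
proof -
  have "path_sum Q \<mu> f g u + path_sum Q \<mu> f (g \<otimes> \<mu> u) (inv\<^bsub>free_group X\<^esub> u) = 0"
    using assms path_sum_mult[of u "inv\<^bsub>free_group X\<^esub> u" g f] by (simp del: free_group_simps(2))
  then show ?thesis by (simp add: bit_add_eq_0_iff)
qed

text \<open>Since \<open>w\<close> is a loop, the way out along \<open>u\<close> and the way back
  cover the same edges and cancel; only the base point of the loop moves.\<close>

lemma path_sum_conj:
  assumes "w \<in> carrier (free_group X)" "\<mu> w = \<one>" "u \<in> carrier (free_group X)" "g \<in> carrier Q"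
  shows "path_sum Q \<mu> f g (u \<otimes>\<^bsub>free_group X\<^esub> w \<otimes>\<^bsub>free_group X\<^esub> inv\<^bsub>free_group X\<^esub> u) =
    path_sum Q \<mu> f (g \<otimes> \<mu> u) w"
proof -
  have "\<mu> (u \<otimes>\<^bsub>free_group X\<^esub> w) = \<mu> u" using assms by (subst hom_mult) auto
  then show ?thesis
    using assms by (simp add: path_sum_mult path_sum_inv del: free_group_simps)
qed

end

lemma path_hom_exponent_sum: "path_hom X integer_group exponent_sum"
  unfolding path_hom_def
  by (simp add: group_hom_def group_hom_axioms_def group_free_group exponent_sum_hom)

subsection \<open>A cocycle on a right-angled Artin group without triangles\<close>

text \<open>For an edge \<open>x0 y0\<close>, the weight \<open>\<alpha> q\<close> on the \<open>x0\<close>-edges of the Cayley graph is chosen such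
  that the commutator square of \<open>x0\<close> and \<open>y0\<close> based at \<open>g\<close> has total weight \<open>q (ht g)\<close>, and all
  other commutator squares have weight 0. Along the \<open>x0\<close>-edges this prescribes the increments of
  \<open>\<alpha> q\<close> in the directions of the link of \<open>x0\<close>. These are consistent since the link has no edges,
  so that it generates a free retract \<open>\<rho>\<close> of the Artin group.\<close>

locale raag_edge = raag_complex +
  fixes x0 y0 :: 'a
  assumes tri: "triangle_free K" and x0y0: "adjacent K x0 y0"
begin

abbreviation "lk \<equiv> {v. adjacent K x0 v}"

lemma x0V [simp]: "x0 \<in> V" and y0V [simp]: "y0 \<in> V"
  using adjacentD[OF x0y0] by auto

text \<open>Two adjacent vertices cannot both lie in the link, as they would form a triangle with
  \<open>x0\<close>. Hence one of their images is trivial and the images commute.\<close>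

lemma retraction_exists:
  "\<exists>\<rho>. \<rho> \<in> hom A (free_group lk) \<and>
    (\<forall>v\<in>V. \<rho> (e v) = (if adjacent K x0 v then [(v, True)] else []))"
proof -
  let ?f = "\<lambda>v. if adjacent K x0 v then [(v, True)] else []"
  have "?f u \<otimes>\<^bsub>free_group lk\<^esub> ?f v = ?f v \<otimes>\<^bsub>free_group lk\<^esub> ?f u" if "adjacent K u v" for u v
  proof -
    have "\<not> (adjacent K x0 u \<and> adjacent K x0 v)"
      using tri that adjacent_sym unfolding triangle_free_def by blast
    then show ?thesis by (auto simp: foldr_reduced_cons_Nil)
  qed
  moreover have "?f \<in> V \<rightarrow> carrier (free_group lk)" by auto
  ultimately obtain h where "h \<in> hom A (free_group lk)" "\<And>v. v \<in> V \<Longrightarrow> h (e v) = ?f v"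
    using raag_universal[OF group_free_group, of ?f lk] by blast
  then show ?thesis by blast
qed

definition \<rho> :: "'a word set \<Rightarrow> 'a word" where
  "\<rho> = (SOME \<rho>. \<rho> \<in> hom A (free_group lk) \<and>
    (\<forall>v\<in>V. \<rho> (e v) = (if adjacent K x0 v then [(v, True)] else [])))"

lemma rho_hom: "\<rho> \<in> hom A (free_group lk)"
  and rho_gen: "v \<in> V \<Longrightarrow> adjacent K x0 v \<Longrightarrow> \<rho> (e v) = [(v, True)]"
  using someI_ex[OF retraction_exists] unfolding \<rho>_def by auto

text \<open>The word \<rho> g is read as a path of heights in which a \<open>y0\<close>-step from
  height h weighs q h. The start is chosen so that the path ends at \<open>ht g\<close>: multiplying
  \<open>g\<close> by \<open>e v\<close> with \<open>v\<close> in the link keeps the start and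
  appends one step from height \<open>ht g\<close>.\<close>

definition \<alpha> :: "(int \<Rightarrow> bit) \<Rightarrow> 'a word set \<Rightarrow> bit" where
  "\<alpha> q g = path_sum integer_group exponent_sum (\<lambda>h x. if x = y0 then q h else 0)
     (ht g - exponent_sum (\<rho> g)) (\<rho> g)"

lemma alpha_step:
  assumes g: "g \<in> carrier A" and v: "adjacent K x0 v"
  shows "\<alpha> q (g \<otimes>\<^bsub>A\<^esub> e v) = \<alpha> q g + (if v = y0 then q (ht g) else 0)"
proof -
  interpret Z: path_hom lk integer_group exponent_sum by (rule path_hom_exponent_sum)
  have V: "v \<in> V" using adjacentD[OF v] by simp
  have rg: "\<rho> g \<in> carrier (free_group lk)" using rho_hom g by (rule hom_in_carrier)
  have eq: "\<rho> (g \<otimes>\<^bsub>A\<^esub> e v) = \<rho> g \<otimes>\<^bsub>free_group lk\<^esub> [(v, True)]"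
    using hom_mult[OF rho_hom g gen_closed[OF V]] rho_gen[OF V v] by simp
  have one: "exponent_sum [(v, True)] = 1" by (simp add: exponent_sum_def)
  have v_lk: "[(v, True)] \<in> carrier (free_group lk)" using v by simp
  have ex: "exponent_sum (\<rho> (g \<otimes>\<^bsub>A\<^esub> e v)) = exponent_sum (\<rho> g) + 1"
    unfolding eq using Z.hom_mult[OF rg v_lk] one by simp
  show ?thesis
    unfolding \<alpha>_def ex using g V by (simp add: eq Z.path_sum_mult[OF rg v_lk] del: free_group_simps)
qed

lemma alpha_add: "\<alpha> (\<lambda>h. q h + q' h) g = \<alpha> q g + \<alpha> q' g"
proof -
  have "(\<lambda>h x. if x = y0 then q h + q' h else (0::bit)) =
      (\<lambda>h x. (if x = y0 then q h else 0) + (if x = y0 then q' h else 0))"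
    by (auto simp: fun_eq_iff)
  then show ?thesis by (simp add: \<alpha>_def path_sum_add)
qed

sublocale path_hom V A \<mu>
  by unfold_locales

definition \<Theta> :: "(int \<Rightarrow> bit) \<Rightarrow> 'a word set \<Rightarrow> 'a word \<Rightarrow> bit" where
  "\<Theta> q = path_sum A \<mu> (\<lambda>g x. if x = x0 then \<alpha> q g else 0)"

lemma Theta_add: "\<Theta> (\<lambda>h. q h + q' h) g w = \<Theta> q g w + \<Theta> q' g w"
proof -
  have "(\<lambda>g x. if x = x0 then \<alpha> (\<lambda>h. q h + q' h) g else 0) =
      (\<lambda>g x. (if x = x0 then \<alpha> q g else 0) + (if x = x0 then \<alpha> q' g else 0))"
    by (auto simp: fun_eq_iff alpha_add)
  then show ?thesis by (simp add: \<Theta>_def path_sum_add)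
qed

lemma Theta_zero: "\<Theta> (\<lambda>_. 0) g w = 0"
  using Theta_add[of "\<lambda>_. 0" "\<lambda>_. 0" g w] by simp

lemma Theta_mult:
  "u \<in> carrier F \<Longrightarrow> v \<in> carrier F \<Longrightarrow> g \<in> carrier A \<Longrightarrow>
    \<Theta> q g (u \<otimes>\<^bsub>F\<^esub> v) = \<Theta> q g u + \<Theta> q (g \<otimes>\<^bsub>A\<^esub> \<mu> u) v"
  unfolding \<Theta>_def by (rule path_sum_mult)

lemma Theta_conj:
  "w \<in> carrier F \<Longrightarrow> \<mu> w = \<one>\<^bsub>A\<^esub> \<Longrightarrow> u \<in> carrier F \<Longrightarrow> g \<in> carrier A \<Longrightarrow>
    \<Theta> q g (u \<otimes>\<^bsub>F\<^esub> w \<otimes>\<^bsub>F\<^esub> inv\<^bsub>F\<^esub> u) = \<Theta> q (g \<otimes>\<^bsub>A\<^esub> \<mu> u) w"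
  unfolding \<Theta>_def by (rule path_sum_conj)

text \<open>Only \<open>x0\<close>-sides carry weight. A square with an \<open>x0\<close>-side has
  two of them, differing by a step in a direction of the link, so \<open>alpha_step\<close>
  evaluates their sum.\<close>

lemma Theta_relator:
  assumes uv: "adjacent K u v" and g: "g \<in> carrier A"
  shows "\<Theta> q g [(u, True), (v, True), (u, False), (v, False)] = (if {u, v} = {x0, y0} then q (ht g) else 0)"
proof -
  have V: "u \<in> V" "v \<in> V" "u \<noteq> v" using adjacentD[OF uv] by auto
  have comm: "e u \<otimes>\<^bsub>A\<^esub> e v = e v \<otimes>\<^bsub>A\<^esub> e u" by (rule gen_commute[OF uv])
  have 1: "g \<otimes>\<^bsub>A\<^esub> e u \<otimes>\<^bsub>A\<^esub> e v \<otimes>\<^bsub>A\<^esub> inv\<^bsub>A\<^esub> e u = g \<otimes>\<^bsub>A\<^esub> e v"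
    using V g A.m_assoc[of g "e u" "e v"] by (simp only: comm) (simp add: A.m_assoc)
  have 2: "g \<otimes>\<^bsub>A\<^esub> e v \<otimes>\<^bsub>A\<^esub> inv\<^bsub>A\<^esub> e v = g" using V g by (simp add: A.m_assoc)
  have "\<Theta> q g [(u, True), (v, True), (u, False), (v, False)] =
      (if u = x0 then \<alpha> q g + \<alpha> q (g \<otimes>\<^bsub>A\<^esub> e v) else 0) +
      (if v = x0 then \<alpha> q (g \<otimes>\<^bsub>A\<^esub> e u) + \<alpha> q g else 0)"
    using V 1 2 by (cases "u = x0"; cases "v = x0") (auto simp: \<Theta>_def mu_gen mu_inv_gen)
  also have "\<dots> = (if {u, v} = {x0, y0} then q (ht g) else 0)"
    using alpha_step[OF g, of v q] alpha_step[OF g, of u q] uv adjacent_sym[OF uv] V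
    by (auto simp: doubleton_eq_iff add.commute)
  finally show ?thesis .
qed

text \<open>On a relator the value depends only on q (ht g), which is periodic. The words of
  \<open>N\<close> with the invariance form a normal subgroup: \<Theta> is additive on loops, and
  conjugation shifts both base points by the same element, preserving their height
  difference.\<close>

lemma Theta_invariant:
  assumes q: "\<And>h k. int n dvd h - k \<Longrightarrow> q h = q k" and w: "w \<in> N"
    and g: "g \<in> carrier A" "g' \<in> carrier A" "int n dvd ht g - ht g'"
  shows "\<Theta> q g w = \<Theta> q g' w"
proof -
  define I where "I w \<longleftrightarrow> (\<forall>g\<in>carrier A. \<forall>g'\<in>carrier A.
     int n dvd ht g - ht g' \<longrightarrow> \<Theta> q g w = \<Theta> q g' w)" for w
  have II: "I w" if "\<And>g g'. g \<in> carrier A \<Longrightarrow> g' \<in> carrier A \<Longrightarrow> int n dvd ht g - ht g' \<Longrightarrow>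
      \<Theta> q g w = \<Theta> q g' w" for w
    unfolding I_def using that by blast
  have ID: "\<Theta> q g w = \<Theta> q g' w"
    if "I w" "g \<in> carrier A" "g' \<in> carrier A" "int n dvd ht g - ht g'" for w g g'
    using that unfolding I_def by blast
  define M where "M = {w \<in> carrier F. \<mu> w = \<one>\<^bsub>A\<^esub> \<and> I w}"
  note [simp del] = free_group_simps(2)
  have "M \<lhd> F"
    unfolding F.normal_inv_iff
  proof (intro conjI ballI)
    show "subgroup M F"
    proof (rule F.subgroupI)
      have "\<Theta> q g \<one>\<^bsub>F\<^esub> = 0" for g by (simp add: \<Theta>_def)
      moreover have "\<mu> \<one>\<^bsub>F\<^esub> = \<one>\<^bsub>A\<^esub>" by (rule mu.hom_one)
      ultimately have "\<one>\<^bsub>F\<^esub> \<in> M" by (simp add: M_def I_def)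
      then show "M \<noteq> {}" by blast
    next
      fix u assume u: "u \<in> M"
      then have Iu: "I u" by (simp add: M_def)
      have "\<Theta> q g (inv\<^bsub>F\<^esub> u) = \<Theta> q g u" if "g \<in> carrier A" for g
        using path_sum_inv[of u g] u that by (simp add: M_def \<Theta>_def)
      then have "I (inv\<^bsub>F\<^esub> u)" by (intro II) (metis ID[OF Iu])
      then show "inv\<^bsub>F\<^esub> u \<in> M" using u mu.hom_inv[of u] by (simp add: M_def)
      fix v assume v: "v \<in> M"
      have Theta_uv: "\<Theta> q g (u \<otimes>\<^bsub>F\<^esub> v) = \<Theta> q g u + \<Theta> q g v" if "g \<in> carrier A" for g
        using u v that by (simp add: M_def Theta_mult)
      have Iv: "I v" using v by (simp add: M_def)
      have "I (u \<otimes>\<^bsub>F\<^esub> v)"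
      proof (rule II)
        fix g g' assume g: "g \<in> carrier A" "g' \<in> carrier A" "int n dvd ht g - ht g'"
        show "\<Theta> q g (u \<otimes>\<^bsub>F\<^esub> v) = \<Theta> q g' (u \<otimes>\<^bsub>F\<^esub> v)"
          unfolding Theta_uv[OF g(1)] Theta_uv[OF g(2)] ID[OF Iu g] ID[OF Iv g] ..
      qed
      moreover have "\<mu> (u \<otimes>\<^bsub>F\<^esub> v) = \<one>\<^bsub>A\<^esub>" using u v mu.hom_mult[of u v] by (simp add: M_def)
      ultimately show "u \<otimes>\<^bsub>F\<^esub> v \<in> M" using u v by (simp add: M_def)
    qed (auto simp: M_def)
  next
    fix u w assume u: "u \<in> carrier F" and w: "w \<in> M"
    have w': "w \<in> carrier F" "\<mu> w = \<one>\<^bsub>A\<^esub>" using w by (auto simp: M_def)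
    have "I (u \<otimes>\<^bsub>F\<^esub> w \<otimes>\<^bsub>F\<^esub> inv\<^bsub>F\<^esub> u)"
    proof (rule II)
      fix g g' assume g: "g \<in> carrier A" "g' \<in> carrier A" "int n dvd ht g - ht g'"
      have "\<Theta> q (g \<otimes>\<^bsub>A\<^esub> \<mu> u) w = \<Theta> q (g' \<otimes>\<^bsub>A\<^esub> \<mu> u) w"
        by (rule ID) (use w g mu.hom_closed[OF u] in \<open>simp_all add: M_def\<close>)
      then show "\<Theta> q g (u \<otimes>\<^bsub>F\<^esub> w \<otimes>\<^bsub>F\<^esub> inv\<^bsub>F\<^esub> u) = \<Theta> q g' (u \<otimes>\<^bsub>F\<^esub> w \<otimes>\<^bsub>F\<^esub> inv\<^bsub>F\<^esub> u)"
        using u g by (simp add: Theta_conj[OF w'])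
    qed
    moreover have "\<mu> (u \<otimes>\<^bsub>F\<^esub> w \<otimes>\<^bsub>F\<^esub> inv\<^bsub>F\<^esub> u) = \<one>\<^bsub>A\<^esub>"
      using u w' mu.hom_closed[OF u] by (simp only: mu.hom_mult mu.hom_inv F.m_closed F.inv_closed A.r_one A.r_inv)
    ultimately show "u \<otimes>\<^bsub>F\<^esub> w \<otimes>\<^bsub>F\<^esub> inv\<^bsub>F\<^esub> u \<in> M" using u w' by (simp add: M_def)
  qed
  moreover have "raag_relators K \<subseteq> M"
  proof
    fix w assume w: "w \<in> raag_relators K"
    then obtain u v where uv: "adjacent K u v" "w = [(u, True), (v, True), (u, False), (v, False)]"
      by (auto simp: raag_relators_def)
    have "w \<in> kernel F A \<mu>" using subsetD[OF normal_closure_superset w] by (simp only: mu_kernel)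
    then have "w \<in> carrier F" "\<mu> w = \<one>\<^bsub>A\<^esub>" by (simp_all add: kernel_def)
    moreover have "I w"
    proof (rule II)
      fix g g' assume g: "g \<in> carrier A" "g' \<in> carrier A" "int n dvd ht g - ht g'"
      have "q (ht g) = q (ht g')" using g(3) by (rule q)
      then show "\<Theta> q g w = \<Theta> q g' w" using uv g by (simp add: Theta_relator)
    qed
    ultimately show "w \<in> M" by (simp add: M_def)
  qed
  ultimately have "N \<subseteq> M" by (rule normal_closure_minimal)
  then have "I w" using w by (auto simp: M_def)
  then show ?thesis using g by (rule ID)
qed

end

subsection \<open>A lower bound for the deficiency\<close>

text \<open>The setting is a surjection \<open>\<mu> \<circ> \<iota>\<close> of a group \<open>B\<close> onto \<open>\<Gamma>\<^sub>n\<close>, where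
  \<open>B\<close> is the free group of an arbitrary presentation of \<open>\<Gamma>\<^sub>n\<close>.\<close>

locale raag_cover = raag_edge + B: group B for B (structure) +
  fixes n :: nat and \<iota> and q :: "int \<Rightarrow> bit" and \<psi> :: "'b \<Rightarrow> bit"
  assumes l_hom: "\<iota> \<in> hom B F"
    and l_onto: "(\<lambda>u. \<mu> (\<iota> u)) ` carrier B = raag_Gamma K n"
    and q_periodic: "\<And>h k. int n dvd h - k \<Longrightarrow> q h = q k"
    and \<psi>_mult: "\<And>u v. u \<in> carrier B \<Longrightarrow> v \<in> carrier B \<Longrightarrow> \<psi> (u \<otimes> v) = \<psi> u + \<psi> v"
begin

definition p :: "'b \<Rightarrow> 'a word set" where
  "p u = \<mu> (\<iota> u)"

text \<open>For free \<open>B\<close>, relator functions induced by homomorphisms \<psi> from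
  \<open>B\<close> to Z/2 represent the zero class. So the class of \<open>q\<close> vanishes iff
  some \<psi> makes this sum vanish on all relators.\<close>

definition \<xi> :: "'b \<Rightarrow> bit" where
  "\<xi> u = \<Theta> q \<one>\<^bsub>A\<^esub> (\<iota> u) + \<psi> u"

sublocale l: group_hom B F \<iota>
  using l_hom by (simp add: group_hom_def group_hom_axioms_def group_free_group B.group_axioms)

lemma p_hom: "p \<in> hom B A"
  using hom_compose[OF l_hom mu.homh] by (simp add: comp_def p_def[abs_def])

sublocale p: group_hom B A p
  using p_hom by (simp add: group_hom_def group_hom_axioms_def group_raag B.group_axioms)

lemma p_dvd: "u \<in> carrier B \<Longrightarrow> int n dvd ht (p u)"
  using l_onto by (auto simp: raag_Gamma_def p_def)

lemma N_iff: "w \<in> N \<longleftrightarrow> w \<in> carrier F \<and> \<mu> w = \<one>\<^bsub>A\<^esub>"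
proof -
  have "w \<in> N \<longleftrightarrow> w \<in> kernel F A \<mu>" by (simp only: mu_kernel)
  then show ?thesis by (simp add: kernel_def)
qed

lemma Theta_Gamma:
  assumes "w \<in> carrier F" "\<mu> w = \<one>\<^bsub>A\<^esub>" "g \<in> carrier A" "int n dvd ht g"
  shows "\<Theta> q g w = \<Theta> q \<one>\<^bsub>A\<^esub> w"
  by (rule Theta_invariant[of n]) (use assms N_iff q_periodic in \<open>auto intro: q_periodic\<close>)

lemma psi_one: "\<psi> \<one> = 0"
  using \<psi>_mult[of \<one> \<one>] by simp

lemma psi_inv: "u \<in> carrier B \<Longrightarrow> \<psi> (inv u) = \<psi> u"
  using \<psi>_mult[of u "inv u"] psi_one by (simp add: bit_add_eq_0_iff)

lemma xi_mult:
  assumes "u \<in> carrier B" "v \<in> carrier B" "p u = \<one>\<^bsub>A\<^esub>"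
  shows "\<xi> (u \<otimes> v) = \<xi> u + \<xi> v"
proof -
  have "\<Theta> q \<one>\<^bsub>A\<^esub> (\<iota> (u \<otimes> v)) = \<Theta> q \<one>\<^bsub>A\<^esub> (\<iota> u) + \<Theta> q \<one>\<^bsub>A\<^esub> (\<iota> v)"
    using Theta_mult[of "\<iota> u" "\<iota> v" "\<one>\<^bsub>A\<^esub>" q] assms l.hom_mult[of u v]
    by (simp add: p_def del: free_group_simps)
  then show ?thesis using assms by (simp add: \<xi>_def \<psi>_mult ac_simps)
qed

lemma xi_one: "\<xi> \<one> = 0"
  using xi_mult[of \<one> \<one>] p.hom_one by simp

text \<open>Conjugation by \<open>b\<close> moves the base point to \<open>p b\<close>, which lies
  in \<Gamma>_n and is invisible to words of \<open>N\<close> by \<open>Theta_Gamma\<close>. So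
  vanishing on relators passes to all their consequences.\<close>

lemma xi_normal_closure:
  assumes R: "R \<subseteq> carrier B" "\<And>r. r \<in> R \<Longrightarrow> p r = \<one>\<^bsub>A\<^esub>" "\<And>r. r \<in> R \<Longrightarrow> \<xi> r = 0"
    and u: "u \<in> normal_closure B R"
  shows "\<xi> u = 0"
proof -
  let ?M = "{u \<in> carrier B. p u = \<one>\<^bsub>A\<^esub> \<and> \<xi> u = 0}"
  have "?M \<lhd> B"
    unfolding B.normal_inv_iff
  proof (intro conjI ballI)
    show "subgroup ?M B"
    proof (rule B.subgroupI)
      show "?M \<noteq> {}" using xi_one p.hom_one by blast
      fix a assume a: "a \<in> ?M"
      have "\<xi> (a \<otimes> inv a) = \<xi> a + \<xi> (inv a)" using a by (intro xi_mult) auto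
      then show "inv a \<in> ?M" using a xi_one by simp
      fix b assume "b \<in> ?M"
      then show "a \<otimes> b \<in> ?M" using a xi_mult[of a b] by simp
    qed auto
    fix b a assume b: "b \<in> carrier B" and a: "a \<in> ?M"
    have a': "a \<in> carrier B" "p a = \<one>\<^bsub>A\<^esub>" "\<xi> a = 0" using a by auto
    have "\<Theta> q \<one>\<^bsub>A\<^esub> (\<iota> (b \<otimes> a \<otimes> inv b)) =
        \<Theta> q \<one>\<^bsub>A\<^esub> (\<iota> b \<otimes>\<^bsub>F\<^esub> \<iota> a \<otimes>\<^bsub>F\<^esub> inv\<^bsub>F\<^esub> \<iota> b)"
      using a' b by (simp add: l.hom_mult del: free_group_simps)
    also have "\<dots> = \<Theta> q (\<one>\<^bsub>A\<^esub> \<otimes>\<^bsub>A\<^esub> \<mu> (\<iota> b)) (\<iota> a)"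
      using a' b by (intro Theta_conj) (auto simp: p_def)
    also have "\<dots> = \<Theta> q \<one>\<^bsub>A\<^esub> (\<iota> a)"
      using a' b p_dvd[OF b] p.hom_closed[OF b] by (intro Theta_Gamma) (auto simp: p_def)
    finally have "\<xi> (b \<otimes> a \<otimes> inv b) = \<xi> a"
      using a' b by (simp add: \<xi>_def \<psi>_mult psi_inv ac_simps)
    moreover have "p (b \<otimes> a \<otimes> inv b) = \<one>\<^bsub>A\<^esub>" using a' b by (simp add: p.hom_mult)
    ultimately show "b \<otimes> a \<otimes> inv b \<in> ?M" using a' b by simp
  qed
  then have "normal_closure B R \<subseteq> ?M"
    using R by (intro normal_closure_minimal) auto
  then show ?thesis using u by auto
qed

end

text \<open>If \<open>\<xi>\<close> vanishes on the whole kernel, then \<open>\<Theta> q\<close> extends from \<open>N\<close> to a homomorphism \<open>\<eta>\<close> on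
  the preimage of \<open>\<Gamma>\<^sub>n\<close> in the free group. Evaluating \<open>\<eta>\<close> on the commutator of an edge \<open>uv\<close>,
  written as a commutator-like product of the elements \<open>x0^c u x0^(-c-1)\<close>, shows that \<open>D c\<close> below is
  constant along all edges other than \<open>x0 y0\<close>, across which it changes by \<open>q c\<close>.\<close>

locale raag_cover_split = raag_cover +
  assumes xi_kernel: "\<And>u. u \<in> carrier B \<Longrightarrow> p u = \<one>\<^bsub>A\<^esub> \<Longrightarrow> \<xi> u = 0"
begin

lemma xi_cong:
  assumes "u \<in> carrier B" "v \<in> carrier B" "p u = p v"
  shows "\<xi> u = \<xi> v"
proof -
  have *: "p (u \<otimes> inv v) = \<one>\<^bsub>A\<^esub>" using assms by simp
  have "\<xi> (u \<otimes> inv v \<otimes> v) = \<xi> (u \<otimes> inv v) + \<xi> v"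
    using assms * by (intro xi_mult) auto
  then show ?thesis using xi_kernel[OF _ *] assms by (simp add: B.m_assoc)
qed

text \<open>If w = v (\<iota> u) with v in \<open>N\<close>, this equals \<Theta> of v plus \<psi>
  u. The choice of the lift u is immaterial by \<open>xi_cong\<close>.\<close>

definition \<eta> :: "'a word \<Rightarrow> bit" where
  "\<eta> w = \<Theta> q \<one>\<^bsub>A\<^esub> w + \<xi> (SOME u. u \<in> carrier B \<and> p u = \<mu> w)"

lemma eta_eq:
  assumes "u \<in> carrier B" "p u = \<mu> w"
  shows "\<eta> w = \<Theta> q \<one>\<^bsub>A\<^esub> w + \<xi> u"
proof -
  let ?s = "SOME u. u \<in> carrier B \<and> p u = \<mu> w"
  have "?s \<in> carrier B \<and> p ?s = \<mu> w" by (rule someI[where x = u]) (simp add: assms)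
  then have "\<xi> ?s = \<xi> u" using assms by (intro xi_cong) auto
  then show ?thesis by (simp add: \<eta>_def)
qed

lemma lift_exists:
  assumes "w \<in> carrier F" "int n dvd ht (\<mu> w)"
  obtains u where "u \<in> carrier B" "p u = \<mu> w"
proof -
  have "\<mu> w \<in> raag_Gamma K n" using assms by (simp add: raag_Gamma_def)
  then show ?thesis using that by (auto simp: p_def simp flip: l_onto)
qed

text \<open>Both summands of \<eta> fail to be additive because the base point moves to \<mu> w. The
  two errors differ by the change of \<Theta> on an element v of \<open>N\<close>, which is 0 as
  \<mu> w lies in \<Gamma>_n, so modulo 2 they cancel.\<close>

lemma eta_mult:
  assumes w: "w \<in> carrier F" "int n dvd ht (\<mu> w)" and w': "w' \<in> carrier F" "int n dvd ht (\<mu> w')"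
  shows "\<eta> (w \<otimes>\<^bsub>F\<^esub> w') = \<eta> w + \<eta> w'"
proof -
  obtain u where u: "u \<in> carrier B" "p u = \<mu> w" using lift_exists[OF w] .
  obtain u' where u': "u' \<in> carrier B" "p u' = \<mu> w'" using lift_exists[OF w'] .
  note [simp del] = free_group_simps
  have "p (u \<otimes> u') = \<mu> (w \<otimes>\<^bsub>F\<^esub> w')" using u u' w w' by simp
  then have eta: "\<eta> (w \<otimes>\<^bsub>F\<^esub> w') = \<Theta> q \<one>\<^bsub>A\<^esub> (w \<otimes>\<^bsub>F\<^esub> w') + \<xi> (u \<otimes> u')"
    using u u' by (intro eta_eq) auto
  define v where "v = w' \<otimes>\<^bsub>F\<^esub> inv\<^bsub>F\<^esub> \<iota> u'"
  have v: "v \<in> carrier F" "\<mu> v = \<one>\<^bsub>A\<^esub>"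
    using w'(1) u' by (auto simp: v_def p_def)
  have w'_eq: "w' = v \<otimes>\<^bsub>F\<^esub> \<iota> u'" using w'(1) u'(1) by (simp add: v_def F.m_assoc)
  have v_split: "\<Theta> q g w' = \<Theta> q g v + \<Theta> q g (\<iota> u')" if "g \<in> carrier A" for g
    unfolding w'_eq using v u'(1) that by (simp add: Theta_mult)
  have "\<Theta> q (\<mu> w) v = \<Theta> q \<one>\<^bsub>A\<^esub> v" using v w by (intro Theta_Gamma) auto
  then have 1: "\<Theta> q (\<mu> w) w' + \<Theta> q (\<mu> w) (\<iota> u') = \<Theta> q \<one>\<^bsub>A\<^esub> w' + \<Theta> q \<one>\<^bsub>A\<^esub> (\<iota> u')"
    using w by (simp add: v_split add.assoc)
  have 2: "\<xi> (u \<otimes> u') = \<Theta> q \<one>\<^bsub>A\<^esub> (\<iota> u) + \<Theta> q (\<mu> w) (\<iota> u') + (\<psi> u + \<psi> u')"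
    using u u' by (simp add: \<xi>_def Theta_mult \<psi>_mult flip: u(2)) (simp add: p_def)
  have 3: "\<Theta> q \<one>\<^bsub>A\<^esub> (w \<otimes>\<^bsub>F\<^esub> w') = \<Theta> q \<one>\<^bsub>A\<^esub> w + \<Theta> q (\<mu> w) w'"
    using w w' by (simp add: Theta_mult)
  have "\<eta> (w \<otimes>\<^bsub>F\<^esub> w') = \<Theta> q \<one>\<^bsub>A\<^esub> w + (\<Theta> q (\<mu> w) w' + \<Theta> q (\<mu> w) (\<iota> u')) + \<Theta> q \<one>\<^bsub>A\<^esub> (\<iota> u)
      + (\<psi> u + \<psi> u')"
    unfolding eta 2 3 by (simp only: ac_simps)
  also have "\<dots> = (\<Theta> q \<one>\<^bsub>A\<^esub> w + \<xi> u) + (\<Theta> q \<one>\<^bsub>A\<^esub> w' + \<xi> u')"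
    unfolding 1 \<xi>_def by (simp only: ac_simps)
  also have "\<dots> = \<eta> w + \<eta> w'" using u u' by (simp only: eta_eq)
  finally show ?thesis .
qed

lemma eta_kernel: "w \<in> carrier F \<Longrightarrow> \<mu> w = \<one>\<^bsub>A\<^esub> \<Longrightarrow> \<eta> w = \<Theta> q \<one>\<^bsub>A\<^esub> w"
  using eta_eq[of \<one> w] xi_one p.hom_one by simp

lemma q_zero:
  assumes nb: "\<not> is_bridge K x0 y0"
  shows "q c = 0"
proof -
  note [simp del] = free_group_simps
  let ?x = "\<lambda>v. [(v, True)] :: 'a word"
  \<comment> \<open>These elements have height 0, so they lie in the preimage of \<Gamma>_n for
    every n, and \<eta> is additive on them.\<close>
  define k where "k c v = ?x x0 [^]\<^bsub>F\<^esub> c \<otimes>\<^bsub>F\<^esub> ?x v \<otimes>\<^bsub>F\<^esub> inv\<^bsub>F\<^esub> (?x x0 [^]\<^bsub>F\<^esub> (c + 1))" for c :: int and v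
  define D where "D v = \<eta> (k c v) + \<eta> (k (c + 1) v)" for v
  have k: "k c v \<in> carrier F" "int n dvd ht (\<mu> (k c v))" if "v \<in> V" for c v
    using that by (simp_all add: k_def mu_gen mu.hom_int_pow)
  have pow: "?x x0 [^]\<^bsub>F\<^esub> c \<in> carrier F" for c :: int by simp
  have edge: "D u + D v = (if {u, v} = {x0, y0} then q c else 0)" if uv: "adjacent K u v" for u v
  proof -
    have V: "u \<in> V" "v \<in> V" "u \<noteq> v" using adjacentD[OF uv] by auto
    define r where "r = [(u, True), (v, True), (u, False), (v, False)]"
    have r_rel: "r \<in> raag_relators K" using uv by (auto simp: r_def raag_relators_def)
    then have "r \<in> N" by (rule subsetD[OF normal_closure_superset])
    then have rF: "r \<in> carrier F" and mr: "\<mu> r = \<one>\<^bsub>A\<^esub>" by (simp_all add: N_iff)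
    have r_eq: "r = ?x u \<otimes>\<^bsub>F\<^esub> ?x v \<otimes>\<^bsub>F\<^esub> inv\<^bsub>F\<^esub> ?x u \<otimes>\<^bsub>F\<^esub> inv\<^bsub>F\<^esub> ?x v"
      using V by (simp add: r_def inv_letter F.m_assoc) (simp add: free_group_simps letter_inv_def)
    let ?g = "?x x0 [^]\<^bsub>F\<^esub> c"
    \<comment> \<open>The powers of \<open>x0\<close> telescope: u and v each occur once at level c
      and once at level c + 1, which is why \<open>D\<close> adds two consecutive levels.\<close>
    have "?g \<otimes>\<^bsub>F\<^esub> r \<otimes>\<^bsub>F\<^esub> inv\<^bsub>F\<^esub> ?g =
        k c u \<otimes>\<^bsub>F\<^esub> k (c + 1) v \<otimes>\<^bsub>F\<^esub> (inv\<^bsub>F\<^esub> k (c + 1) u \<otimes>\<^bsub>F\<^esub> inv\<^bsub>F\<^esub> k c v)"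
      unfolding r_eq k_def using V pow by (simp add: F.word_simps)
    moreover have "\<eta> (?g \<otimes>\<^bsub>F\<^esub> r \<otimes>\<^bsub>F\<^esub> inv\<^bsub>F\<^esub> ?g) = (if {u, v} = {x0, y0} then q c else 0)"
    proof -
      have "\<mu> (?g \<otimes>\<^bsub>F\<^esub> r \<otimes>\<^bsub>F\<^esub> inv\<^bsub>F\<^esub> ?g) = \<one>\<^bsub>A\<^esub>"
        using pow rF mr by simp
      then have "\<eta> (?g \<otimes>\<^bsub>F\<^esub> r \<otimes>\<^bsub>F\<^esub> inv\<^bsub>F\<^esub> ?g) = \<Theta> q (\<one>\<^bsub>A\<^esub> \<otimes>\<^bsub>A\<^esub> \<mu> ?g) r"
        using pow rF mr Theta_conj by (simp add: eta_kernel)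
      moreover have "ht (\<one>\<^bsub>A\<^esub> \<otimes>\<^bsub>A\<^esub> \<mu> ?g) = c"
        by (simp add: mu.hom_int_pow mu_gen)
      ultimately show ?thesis using Theta_relator[OF uv, of "\<one>\<^bsub>A\<^esub> \<otimes>\<^bsub>A\<^esub> \<mu> ?g" q] pow
        by (simp add: r_def)
    qed
    moreover have "\<eta> (inv\<^bsub>F\<^esub> w) = \<eta> w" if "w \<in> carrier F" "int n dvd ht (\<mu> w)" for w
    proof -
      have "\<eta> (w \<otimes>\<^bsub>F\<^esub> inv\<^bsub>F\<^esub> w) = \<eta> w + \<eta> (inv\<^bsub>F\<^esub> w)" using that by (intro eta_mult) auto
      moreover have "\<eta> \<one>\<^bsub>F\<^esub> = 0" using eta_mult[of "\<one>\<^bsub>F\<^esub>" "\<one>\<^bsub>F\<^esub>"] mu.hom_one by simp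
      ultimately show ?thesis using that by (simp add: bit_add_eq_0_iff)
    qed
    ultimately have "(if {u, v} = {x0, y0} then q c else 0) =
        \<eta> (k c u) + \<eta> (k (c + 1) v) + (\<eta> (k (c + 1) u) + \<eta> (k c v))"
      using V k by (simp add: eta_mult)
    then show ?thesis unfolding D_def by (simp only: ac_simps)
  qed
  let ?R = "\<lambda>u v. adjacent K u v \<and> {u, v} \<noteq> {x0, y0}"
  have "?R\<^sup>*\<^sup>* x0 y0" using nb by (simp add: is_bridge_def)
  \<comment> \<open>Along the path that avoids the edge \<open>D\<close> does not change, whereas
    the edge itself gives D x0 + D y0 = q c.\<close>
  then have "D x0 = D y0"
  proof (induction rule: rtranclp_induct)
    case (step u v)
    then show ?case using edge[of u v] by (simp add: bit_add_eq_0_iff)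
  qed simp
  then show ?thesis using edge[OF x0y0] by simp
qed

end

section \<open>Homomorphisms from a free group to Z/2, and counting them\<close>

definition letter_sum :: "('a \<Rightarrow> bit) \<Rightarrow> 'a word \<Rightarrow> bit" where
  "letter_sum b w = (\<Sum>l\<leftarrow>w. b (fst l))"

text \<open>A weight independent of the base point turns the crossed-homomorphism rule into plain
  additivity.\<close>

lemma letter_sum_mult:
  assumes "u \<in> carrier (free_group X)" "v \<in> carrier (free_group X)"
  shows "letter_sum b (u \<otimes>\<^bsub>free_group X\<^esub> v) = letter_sum b u + letter_sum b v"
proof -
  interpret path_hom X integer_group exponent_sum by (rule path_hom_exponent_sum)
  show ?thesis
    using path_sum_mult[OF assms, of 0 "\<lambda>_. b"] by (simp add: path_sum_const letter_sum_def del: free_group_simps)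
qed

lemma letter_sum_add: "letter_sum (\<lambda>x. b x + b' x) w = letter_sum b w + letter_sum b' w"
  by (induction w) (auto simp: letter_sum_def ac_simps)

lemma UNIV_bit: "(UNIV :: bit set) = {0, 1}"
  by (auto intro: bit.exhaust)

lemma finite_UNIV_bit [simp]: "finite (UNIV :: bit set)"
  by (simp add: UNIV_bit)

lemma card_bit_functions: "finite S \<Longrightarrow> card (S \<rightarrow>\<^sub>E (UNIV :: bit set)) = 2 ^ card S"
  by (simp add: card_PiE UNIV_bit numeral_2_eq_2)

section \<open>Generators of \<Gamma>_n and the inequality for a single presentation\<close>

context raag_complex
begin

lemma finite_edge_elts:
  assumes "finite V"
  shows "finite edge_elts"
proof -
  have "edge_elts \<subseteq> (\<lambda>(u, v). e u \<otimes>\<^bsub>A\<^esub> inv\<^bsub>A\<^esub> e v) ` (V \<times> V)" using adjacentD by auto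
  then show ?thesis by (rule finite_subset) (simp add: assms)
qed

text \<open>The exponent of \<open>e r\<close> in \<open>edge_elts_generate\<close> is the height,
  here a multiple of \<open>n\<close>. The size of the generating set is bounded independently of
  \<open>n\<close> and supplies the constant in the lower bound.\<close>

lemma Gamma_generated:
  assumes conn: "connected_complex K" and r: "r \<in> V"
  shows "raag_Gamma K n \<subseteq> generate A (insert (e r [^]\<^bsub>A\<^esub> n) edge_elts)" (is "_ \<subseteq> ?G")
proof
  fix g assume "g \<in> raag_Gamma K n"
  then have g: "g \<in> carrier A" "int n dvd ht g" by (auto simp: raag_Gamma_def)
  have incl: "insert (e r [^]\<^bsub>A\<^esub> n) edge_elts \<subseteq> carrier A" using adjacentD r by auto
  then interpret G: subgroup ?G A by (rule A.generate_is_subgroup)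
  obtain b where b: "b \<in> generate A edge_elts" "g = b \<otimes>\<^bsub>A\<^esub> e r [^]\<^bsub>A\<^esub> ht g"
    using edge_elts_generate[OF conn r g(1)] .
  obtain k where "ht g = int n * k" using g(2) by auto
  then have "e r [^]\<^bsub>A\<^esub> ht g = (e r [^]\<^bsub>A\<^esub> n) [^]\<^bsub>A\<^esub> k"
    using r by (simp add: A.int_pow_pow flip: int_pow_int)
  also have "\<dots> \<in> ?G"
    by (rule A.subgroup_int_pow_closed[OF G.subgroup_axioms generate.incl]) simp
  finally have "e r [^]\<^bsub>A\<^esub> ht g \<in> ?G" .
  moreover have "b \<in> ?G" using b(1) A.mono_generate[of edge_elts "insert (e r [^]\<^bsub>A\<^esub> n) edge_elts"] by blast
  ultimately show "g \<in> ?G" by (subst b(2)) (rule G.m_closed)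
qed

end

context raag_edge
begin

text \<open>The additive map \<Phi> from (Z/2)^n x (Z/2)^d to functions on \<open>R\<close> and on
  \<open>S\<close> is injective, and sizes are compared. If \<Xi> vanishes on \<open>R\<close>, then
  q = 0 because the edge lies on a cycle; so \<open>letter_sum b\<close> vanishes on the kernel of
  \<open>p0\<close> and descends to \<Gamma>_n, where its values on the generators \<open>S\<close>
  determine it.\<close>

lemma Gamma_presentation_bound:
  assumes fin: "finite V" and conn: "connected_complex K" and nb: "\<not> is_bridge K x0 y0"
    and n: "n > 0" and pres: "is_finite_presentation (A\<lparr>carrier := raag_Gamma K n\<rparr>) d R"
  shows "n + d \<le> card R + Suc (card edge_elts)"
proof -
  let ?B = "free_group {..<d}" and ?\<Gamma> = "A\<lparr>carrier := raag_Gamma K n\<rparr>"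
  interpret B: group ?B by (rule group_free_group)
  have \<Gamma>: "group ?\<Gamma>" by (rule subgroup.subgroup_is_group[OF subgroup_raag_Gamma group_raag])
  obtain p0 where p0: "presents p0 {..<d} R ?\<Gamma>" and R: "finite R" "R \<subseteq> carrier ?B"
    using pres by (auto simp: is_finite_presentation_iff[OF \<Gamma>])
  have p0_im: "p0 ` carrier ?B = raag_Gamma K n" using p0 by (simp add: presents_def)
  have \<Gamma>A: "raag_Gamma K n \<subseteq> carrier A" by (auto simp: raag_Gamma_def)
  have p0_hom: "p0 \<in> hom ?B A" using p0 \<Gamma>A unfolding presents_def hom_def by auto
  interpret p0: group_hom ?B A p0
    using p0_hom by (simp add: group_hom_def group_hom_axioms_def group_raag group_free_group)
  have p0_ker: "u \<in> normal_closure ?B R" if "u \<in> carrier ?B" "p0 u = \<one>\<^bsub>A\<^esub>" for u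
  proof -
    have "u \<in> kernel ?B ?\<Gamma> p0" using that by (simp add: kernel_def)
    then show ?thesis using p0 by (simp add: presents_def)
  qed
  have p0_R: "p0 r = \<one>\<^bsub>A\<^esub>" if "r \<in> R" for r
  proof -
    have "r \<in> kernel ?B ?\<Gamma> p0"
      using p0 subsetD[OF normal_closure_superset that] by (simp add: presents_def)
    then show ?thesis by (simp add: kernel_def)
  qed
  have "\<exists>w. w \<in> carrier F \<and> \<mu> w = p0 [(i, True)]" if "i < d" for i
    using mu_surj[OF p0.hom_closed, of "[(i, True)]"] that by auto
  then obtain f where f: "\<And>i. i < d \<Longrightarrow> f i \<in> carrier F" "\<And>i. i < d \<Longrightarrow> \<mu> (f i) = p0 [(i, True)]"
    by metis
  define \<iota> where "\<iota> = free_lift F f"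
  have \<iota>_hom: "\<iota> \<in> hom ?B F"
    unfolding \<iota>_def using f(1) by (intro free_lift_hom group_free_group) auto
  have \<mu>\<iota>: "\<mu> (\<iota> u) = p0 u" if "u \<in> carrier ?B" for u
  proof (rule hom_free_group_eqI[OF group_raag _ p0_hom _ that])
    show "(\<lambda>u. \<mu> (\<iota> u)) \<in> hom ?B A" using hom_compose[OF \<iota>_hom mu.homh] by (simp add: comp_def)
  qed (use f in \<open>simp add: \<iota>_def group_free_group\<close>)
  have onto: "(\<lambda>u. \<mu> (\<iota> u)) ` carrier ?B = raag_Gamma K n"
    using \<mu>\<iota> p0_im by simp
  \<comment> \<open>These are the \<open>n\<close> free parameters: \<open>a\<close> prescribes one
    value for each residue class of heights modulo \<open>n\<close>.\<close>
  define q :: "(nat \<Rightarrow> bit) \<Rightarrow> int \<Rightarrow> bit" where "q a h = a (nat (h mod int n))" for a h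
  have q_periodic: "q a h = q a k" if "int n dvd h - k" for a h k
    using that by (simp add: q_def mod_eq_dvd_iff[THEN iffD2])
  have cover: "raag_cover K x0 y0 ?B n \<iota> (q a) (letter_sum b)" for a b
    by (intro raag_cover.intro raag_cover_axioms.intro raag_edge_axioms group_free_group
        \<iota>_hom onto q_periodic letter_sum_mult)
  define \<Xi> where "\<Xi> a b u = \<Theta> (q a) \<one>\<^bsub>A\<^esub> (\<iota> u) + letter_sum b u" for a b u
  define S where "S = insert (e x0 [^]\<^bsub>A\<^esub> n) edge_elts"
  have S_fin: "finite S" using finite_edge_elts[OF fin] by (simp add: S_def)
  have "S \<subseteq> raag_Gamma K n"
    unfolding S_def using adjacentD by (auto simp: raag_Gamma_def)
  then have "\<exists>u. u \<in> carrier ?B \<and> p0 u = s" if "s \<in> S" for s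
  proof -
    have "s \<in> p0 ` carrier ?B" using \<open>S \<subseteq> raag_Gamma K n\<close> that by (auto simp only: p0_im)
    then show ?thesis by auto
  qed
  then obtain \<sigma> where \<sigma>: "\<And>s. s \<in> S \<Longrightarrow> \<sigma> s \<in> carrier ?B" "\<And>s. s \<in> S \<Longrightarrow> p0 (\<sigma> s) = s"
    by metis
  have zero: "(\<forall>i<n. a i = 0) \<and> (\<forall>i<d. b i = 0)"
    if \<Xi>_R: "\<And>r. r \<in> R \<Longrightarrow> \<Xi> a b r = 0" and \<psi>_S: "\<And>s. s \<in> S \<Longrightarrow> letter_sum b (\<sigma> s) = 0" for a b
  proof -
    interpret C: raag_cover K x0 y0 ?B n \<iota> "q a" "letter_sum b" by (rule cover)
    have C_p: "C.p u = p0 u" if "u \<in> carrier ?B" for u using that \<mu>\<iota> by (simp add: C.p_def)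
    have ker: "C.\<xi> u = 0" if "u \<in> carrier ?B" "C.p u = \<one>\<^bsub>A\<^esub>" for u
    proof (rule C.xi_normal_closure[OF R(2)])
      fix r assume r: "r \<in> R"
      show "C.p r = \<one>\<^bsub>A\<^esub>" using r R(2) p0_R C_p by (metis subsetD)
      show "C.\<xi> r = 0" using \<Xi>_R[OF r] by (simp add: C.\<xi>_def \<Xi>_def)
    qed (use that p0_ker C_p in simp)
    interpret C: raag_cover_split K x0 y0 ?B n \<iota> "q a" "letter_sum b"
      by unfold_locales (rule ker)
    have q0: "q a c = 0" for c by (rule C.q_zero[OF nb])
    have "a i = 0" if "i < n" for i using q0[of "int i"] that by (simp add: q_def)
    moreover have "b i = 0" if i: "i < d" for i
    proof -
      have "q a = (\<lambda>_. 0)" using q0 by (simp add: fun_eq_iff)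
      then have \<psi>_ker: "letter_sum b u = 0" if "u \<in> carrier ?B" "p0 u = \<one>\<^bsub>A\<^esub>" for u
        using ker[of u] that C_p unfolding C.\<xi>_def by (simp add: Theta_zero)
      let ?T = "{u \<in> carrier ?B. letter_sum b u = 0}"
      have T: "subgroup ?T ?B"
      proof (rule B.subgroupI)
        show "?T \<noteq> {}" using C.psi_one by blast
        fix u assume u: "u \<in> ?T"
        then show "inv\<^bsub>?B\<^esub> u \<in> ?T" using C.psi_inv[of u] by simp
        fix v assume "v \<in> ?T"
        then show "u \<otimes>\<^bsub>?B\<^esub> v \<in> ?T" using u C.\<psi>_mult[of u v] by simp
      qed auto
      have "generate A S \<subseteq> p0 ` ?T"
      proof (rule A.generate_subgroup_incl[OF _ p0.subgroup_img_is_subgroup[OF T]])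
        show "S \<subseteq> p0 ` ?T"
        proof
          fix s assume s: "s \<in> S"
          show "s \<in> p0 ` ?T" by (rule image_eqI[of _ _ "\<sigma> s"]) (use s \<sigma> \<psi>_S in auto)
        qed
      qed
      then have im: "raag_Gamma K n \<subseteq> p0 ` ?T"
        using Gamma_generated[OF conn x0V, of n] unfolding S_def by (rule order.trans[rotated])
      let ?u = "[(i, True)]"
      have u: "?u \<in> carrier ?B" using i by simp
      then have "p0 ?u \<in> p0 ` ?T" using im p0_im by blast
      then obtain v where v: "v \<in> carrier ?B" "letter_sum b v = 0" "p0 ?u = p0 v" by auto
      have "p0 (?u \<otimes>\<^bsub>?B\<^esub> inv\<^bsub>?B\<^esub> v) = \<one>\<^bsub>A\<^esub>"
        using u v p0.hom_closed[OF v(1)] by (simp only: p0.hom_mult p0.hom_inv B.inv_closed A.r_inv)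
      then have "letter_sum b (?u \<otimes>\<^bsub>?B\<^esub> inv\<^bsub>?B\<^esub> v) = 0"
        by (rule \<psi>_ker[OF B.m_closed[OF u B.inv_closed[OF v(1)]]])
      then have "letter_sum b ?u = 0"
        using C.\<psi>_mult[OF u B.inv_closed[OF v(1)]] C.psi_inv[OF v(1)] v(2) by simp
      then show ?thesis by (simp add: letter_sum_def)
    qed
    ultimately show ?thesis by blast
  qed
  let ?dom = "({..<n} \<rightarrow>\<^sub>E (UNIV :: bit set)) \<times> ({..<d} \<rightarrow>\<^sub>E (UNIV :: bit set))"
  let ?cod = "(R \<rightarrow>\<^sub>E (UNIV :: bit set)) \<times> (S \<rightarrow>\<^sub>E (UNIV :: bit set))"
  define \<Phi> where "\<Phi> = (\<lambda>(a, b). (\<lambda>r\<in>R. \<Xi> a b r, \<lambda>s\<in>S. letter_sum b (\<sigma> s)))"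
  have "inj_on \<Phi> ?dom"
  \<comment> \<open>Differences are sums modulo 2, so injectivity follows from \<open>zero\<close>
    applied to the sum of two arguments with equal image.\<close>
  proof (rule inj_onI, clarify)
    fix a b a' b'
    assume a: "a \<in> {..<n} \<rightarrow>\<^sub>E (UNIV :: bit set)" "a' \<in> {..<n} \<rightarrow>\<^sub>E (UNIV :: bit set)"
      and b: "b \<in> {..<d} \<rightarrow>\<^sub>E (UNIV :: bit set)" "b' \<in> {..<d} \<rightarrow>\<^sub>E (UNIV :: bit set)"
      and eq: "\<Phi> (a, b) = \<Phi> (a', b')"
    have eqR: "\<Xi> a b r = \<Xi> a' b' r" if "r \<in> R" for r
      using eq that by (auto simp: \<Phi>_def dest!: fun_cong[of _ _ r])
    have eqS: "letter_sum b (\<sigma> s) = letter_sum b' (\<sigma> s)" if "s \<in> S" for s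
      using eq that by (auto simp: \<Phi>_def dest!: fun_cong[of _ _ s])
    have q_add: "q (\<lambda>i. a i + a' i) = (\<lambda>h. q a h + q a' h)" by (simp add: q_def fun_eq_iff)
    have "\<Xi> (\<lambda>i. a i + a' i) (\<lambda>i. b i + b' i) r = \<Xi> a b r + \<Xi> a' b' r" for r
      unfolding \<Xi>_def q_add Theta_add letter_sum_add by (simp only: ac_simps)
    then have "(\<forall>i<n. a i + a' i = 0) \<and> (\<forall>i<d. b i + b' i = 0)"
      using eqR eqS by (intro zero) (simp_all add: letter_sum_add)
    then show "a = a' \<and> b = b'"
      using PiE_ext[OF a] PiE_ext[OF b] by (simp add: bit_add_eq_0_iff)
  qed
  moreover have "\<Phi> ` ?dom \<subseteq> ?cod" by (auto simp: \<Phi>_def)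
  moreover have "finite ?cod" using R(1) S_fin by (intro finite_cartesian_product finite_PiE) auto
  ultimately have "card ?dom \<le> card ?cod" by (rule card_inj_on_le)
  then have "(2::nat) ^ (n + d) \<le> 2 ^ (card R + card S)"
    using R(1) S_fin by (simp add: card_cartesian_product card_bit_functions power_add)
  then have "n + d \<le> card R + card S" by simp
  moreover have "card S \<le> Suc (card edge_elts)"
    unfolding S_def by (rule card_insert_le_m1) simp_all
  ultimately show ?thesis by simp
qed

lemma deficiency_Gamma_tendsto:
  assumes "finite V" "connected_complex K" "\<not> is_bridge K x0 y0"
  shows "(\<lambda>n. deficiency (A\<lparr>carrier := raag_Gamma K n\<rparr>)) \<longlonglongrightarrow> \<infinity>"
  unfolding tendsto_PInfty
proof
  fix c :: real
  let ?C = "real (Suc (card edge_elts))"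
  \<comment> \<open>Beyond this threshold \<open>n\<close> is also positive, as
    \<open>Gamma_presentation_bound\<close> requires.\<close>
  have "ereal c < deficiency (A\<lparr>carrier := raag_Gamma K n\<rparr>)" if n: "n > nat \<lceil>c + ?C + 1\<rceil>" for n
  proof -
    have "ereal (real n - ?C) \<le> deficiency (A\<lparr>carrier := raag_Gamma K n\<rparr>)"
      unfolding deficiency_def
    proof (rule Inf_greatest, clarify)
      fix d R assume "is_finite_presentation (A\<lparr>carrier := raag_Gamma K n\<rparr>) d R"
      from Gamma_presentation_bound[OF assms _ this] n
      have "real (n + d) \<le> real (card R + Suc (card edge_elts))" by (intro of_nat_mono) simp
      then show "ereal (real n - ?C) \<le> ereal (real (card R) - real d)" by simp
    qed
    moreover have "c < real n - ?C" using n by linarith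
    ultimately show ?thesis by (meson ereal_less_le less_ereal.simps(1) order_less_le_trans)
  qed
  then show "\<forall>\<^sub>F n in sequentially. ereal c < deficiency (A\<lparr>carrier := raag_Gamma K n\<rparr>)"
    using eventually_gt_at_top[of "nat \<lceil>c + ?C + 1\<rceil>"] by (rule eventually_mono[rotated])
qed

end

subsection \<open>Bounded deficiency\<close>

context raag_complex
begin

lemma H_normal_Gamma: "raag_H K \<lhd> A\<lparr>carrier := raag_Gamma K n\<rparr>"
  by (rule A.normal_restrict_supergroup[OF subgroup_raag_Gamma])
    (auto simp: raag_H_def pi.normal_kernel, auto simp: kernel_def raag_Gamma_def)

lemma deficiency_Gamma_bounded:
  assumes fp: "finitely_presentable (A\<lparr>carrier := raag_H K\<rparr>)"
  shows "\<exists>c::real. \<forall>n>0. deficiency (A\<lparr>carrier := raag_Gamma K n\<rparr>) \<le> ereal c"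
proof -
  obtain d R where R: "is_finite_presentation (A\<lparr>carrier := raag_H K\<rparr>) d R"
    using fp by (auto simp: finitely_presentable_def)
  have upper: "deficiency (A\<lparr>carrier := raag_Gamma K n\<rparr>) \<le> ereal (real (card R') - real d')"
    if "is_finite_presentation (A\<lparr>carrier := raag_Gamma K n\<rparr>) d' R'" for n d' R'
    unfolding deficiency_def using that by (intro Inf_lower) blast
  show ?thesis
  proof (cases "V = {}")
    \<comment> \<open>The empty complex offers no generator \<open>e r\<close> to split off; there
      \<open>A\<close> is trivial and each \<Gamma>_n equals H.\<close>
    case True
    have "g = \<one>\<^bsub>A\<^esub>" if "g \<in> carrier A" for g
      using raag_subgroup_eqI[OF A.triv_subgroup _ that] True by blast
    then have "ht g = 0" if "g \<in> carrier A" for g using that ht_one by metis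
    then have "raag_Gamma K n = raag_H K" for n by (auto simp: raag_Gamma_def H_iff)
    then show ?thesis using upper R by metis
  next
    case False
    then obtain r where r: "r \<in> V" by auto
    have "deficiency (A\<lparr>carrier := raag_Gamma K n\<rparr>) \<le> ereal (real (card R))" if n: "n > 0" for n
    proof -
      let ?\<Gamma> = "A\<lparr>carrier := raag_Gamma K n\<rparr>" and ?t = "e r [^]\<^bsub>A\<^esub> n"
      have grp: "group ?\<Gamma>" by (rule subgroup.subgroup_is_group[OF subgroup_raag_Gamma group_raag])
      have t: "?t \<in> raag_Gamma K n" using r by (simp add: raag_Gamma_def)
      have pow: "?t [^]\<^bsub>?\<Gamma>\<^esub> k = ?t [^]\<^bsub>A\<^esub> k" for k :: int
        using A.int_pow_consistent[OF subgroup_raag_Gamma t] by simp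
      obtain R' where R': "is_finite_presentation ?\<Gamma> (Suc d) R'" "card R' \<le> card R + d"
      proof (rule is_finite_presentation_semidirect[OF grp H_normal_Gamma, of ?t d R])
        show "?t \<in> carrier ?\<Gamma>" using t by simp
        show "is_finite_presentation (?\<Gamma>\<lparr>carrier := raag_H K\<rparr>) d R" using R by simp
        show "k = 0" if "?t [^]\<^bsub>?\<Gamma>\<^esub> k \<in> raag_H K" for k :: int
          using that r n by (simp add: pow H_iff)
        show "\<exists>h\<in>raag_H K. \<exists>k::int. g = h \<otimes>\<^bsub>?\<Gamma>\<^esub> ?t [^]\<^bsub>?\<Gamma>\<^esub> k" if "g \<in> carrier ?\<Gamma>" for g
        proof -
          have g: "g \<in> carrier A" "int n dvd ht g" using that by (auto simp: raag_Gamma_def)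
          then obtain k where k: "ht g = int n * k" by auto
          have "g \<otimes>\<^bsub>A\<^esub> inv\<^bsub>A\<^esub> (?t [^]\<^bsub>A\<^esub> k) \<in> raag_H K" using g r k by (simp add: H_iff)
          moreover have "g = g \<otimes>\<^bsub>A\<^esub> inv\<^bsub>A\<^esub> (?t [^]\<^bsub>A\<^esub> k) \<otimes>\<^bsub>A\<^esub> ?t [^]\<^bsub>A\<^esub> k"
            using g r by (simp add: A.m_assoc)
          ultimately show ?thesis unfolding pow by auto
        qed
      qed
      have "deficiency ?\<Gamma> \<le> ereal (real (card R') - real (Suc d))" by (rule upper[OF R'(1)])
      \<comment> \<open>There are at most \<open>card R + d\<close> relators against
        \<open>d + 1\<close> generators, so \<open>d\<close> cancels and the bound does not depend
        on \<open>n\<close>.\<close>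
      also have "\<dots> \<le> ereal (real (card R))" using R'(2) by simp
      finally show ?thesis .
    qed
    then show ?thesis by blast
  qed
qed

text \<open>Covers the empty complex, so that elsewhere a base vertex may be chosen.\<close>

lemma trivial_finitely_presentable:
  assumes "V = {}"
  shows "finitely_presentable (A\<lparr>carrier := raag_H K\<rparr>)"
proof -
  let ?H = "A\<lparr>carrier := raag_H K\<rparr>" and ?B = "free_group ({} :: nat set)"
  have "g = \<one>\<^bsub>A\<^esub>" if "g \<in> carrier A" for g
    using raag_subgroup_eqI[OF A.triv_subgroup _ that] assms by blast
  then have H: "raag_H K = {\<one>\<^bsub>A\<^esub>}" using A.one_closed by (auto simp: H_iff)
  have B: "carrier ?B = {[]}" by (auto simp: free_group_carrier_iff)
  have Hgrp: "group ?H" by (rule subgroup.subgroup_is_group[OF subgroup_raag_H group_raag])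
  have "[] \<in> normal_closure ?B {}"
    using subgroup.one_closed[OF normal_imp_subgroup[OF normal_closure_normal[OF group_free_group]], of "{}" "{} :: nat set"]
    by simp
  moreover have hom: "(\<lambda>_. \<one>\<^bsub>A\<^esub>) \<in> hom ?B ?H" by (simp add: hom_def H)
  moreover have "normal_closure ?B {} \<subseteq> kernel ?B ?H (\<lambda>_. \<one>\<^bsub>A\<^esub>)"
    by (rule normal_closure_subset_kernel[OF group_free_group Hgrp hom]) simp
  ultimately have "presents (\<lambda>_. \<one>\<^bsub>A\<^esub>) ({} :: nat set) {} ?H"
    by (auto simp: presents_def kernel_def B H)
  then have "is_finite_presentation ?H 0 {}"
    using is_finite_presentation_iff[OF Hgrp, of 0 "{}"] by auto
  then show ?thesis unfolding finitely_presentable_def by blast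
qed

end

theorem corollaryC:
  fixes K :: "'a set set"
  assumes "finite_simplicial_complex K"
    and "flag_complex K"
    and "connected_complex K"
    and "triangle_free K"
  shows "raag_H K = (\<Inter>n\<in>{1..}. raag_Gamma K n) \<and>
    (((\<lambda>n. deficiency (raag K\<lparr>carrier := raag_Gamma K n\<rparr>)) \<longlonglongrightarrow> \<infinity>) \<longleftrightarrow>
     \<not> finitely_presentable (raag K\<lparr>carrier := raag_H K\<rparr>))"
proof (intro conjI iffI notI)
  interpret raag_complex K .
  have fin: "finite V"
    using assms(1) by (auto simp: finite_simplicial_complex_def vertices_def)
  show "raag_H K = (\<Inter>n\<in>{1..}. raag_Gamma K n)" by (rule H_eq_Inter_Gamma)
  show False
    if lim: "(\<lambda>n. deficiency (A\<lparr>carrier := raag_Gamma K n\<rparr>)) \<longlonglongrightarrow> \<infinity>"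
      and fp: "finitely_presentable (A\<lparr>carrier := raag_H K\<rparr>)"
  proof -
    obtain c where c: "\<And>n. n > 0 \<Longrightarrow> deficiency (A\<lparr>carrier := raag_Gamma K n\<rparr>) \<le> ereal c"
      using deficiency_Gamma_bounded[OF fp] by blast
    have "\<forall>\<^sub>F n in sequentially. ereal c < deficiency (A\<lparr>carrier := raag_Gamma K n\<rparr>)"
      using lim unfolding tendsto_PInfty by blast
    then have "\<forall>\<^sub>F n in sequentially. False"
      using eventually_gt_at_top[of "0::nat"] by eventually_elim (use c in \<open>simp add: not_less[symmetric]\<close>)
    then show False by simp
  qed
  show "(\<lambda>n. deficiency (A\<lparr>carrier := raag_Gamma K n\<rparr>)) \<longlonglongrightarrow> \<infinity>"
    if nfp: "\<not> finitely_presentable (A\<lparr>carrier := raag_H K\<rparr>)"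
  proof -
    obtain r where "r \<in> V" using trivial_finitely_presentable nfp by auto
    \<comment> \<open>If every edge were a bridge, the graph would be a tree and H finitely
      presentable; so some edge lies on a cycle.\<close>
    then obtain x0 y0 where adj: "adjacent K x0 y0" and nb: "\<not> is_bridge K x0 y0"
      using tree_H_finitely_presentable[OF fin assms(3)] nfp by blast
    interpret raag_edge K x0 y0
      by unfold_locales (rule assms(4), rule adj)
    show ?thesis by (rule deficiency_Gamma_tendsto[OF fin assms(3) nb])
  qed
qed

end
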